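(* Let $V=\bigotimes_{i=1}^nV_i$ with $\dim V_i=d_i$. The ring $k[\mathrm{End}(V)^{\oplus m}]^{\mathrm{GL}_{\mathbf d}}$ of $\mathrm{GL}_{\mathbf d}$-invariants of $\mathrm{End}(V)^{\oplus m}$ is generated by the functions $\mathrm{Tr}^P_\sigma$, where $P$ ranges over finite vectors with entries in $\{1,\dots,m\}$ and $\sigma$ ranges over $\mathcal S^n_{|P|}$.
   Context: $k$ is an algebraically closed field of characteristic zero; the $V_i$ are $k$-vector spaces of finite dimension $d_i$; $\mathrm{GL}_{\mathbf d}=\times_{i=1}^n\mathrm{GL}(k^{d_i})$ acts on $\mathrm{End}(V)=\bigotimes_i\mathrm{End}(V_i)$ by conjugation by $\bigotimes_ig_i$, and on $\mathrm{End}(V)^{\oplus m}$ by simultaneous conjugation. $k[W]$ is the ring of polynomial functions on $W$ and $k[W]^G$ the subring of invariants; "generated" means as a $k$-algebra. For $\ell\ge1$ and $\sigma=(\sigma_1,\dots,\sigma_n)\in\mathcal S_\ell^n$ (the $n$-fold product of the symmetric group on $\ell$ letters), write each $\sigma_i=(r_1\cdots r_a)(s_1\cdots s_b)\cdots$ as a product of disjoint cycles (fixed points included). The function $\mathrm{Tr}_\sigma=T_{\sigma_1}\cdots T_{\sigma_n}$ on $\mathrm{End}(V)^{\oplus \ell}$ is defined on tuples of simple tensors by $$T_{\sigma_i}\Big(\bigotimes_{j=1}^nM_{j1},\dots,\bigotimes_{j=1}^nM_{j\ell}\Big)=\mathrm{Tr}(M_{ir_1}\cdots M_{ir_a})\,\mathrm{Tr}(M_{is_1}\cdots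 M_{is_b})\cdots\qquad (M_{jl}\in\mathrm{End}(V_j)),$$ with the product $\mathrm{Tr}_\sigma$ extended multilinearly. For a vector $P=(p_1,\dots,p_{|P|})$ with all $p_i\in\{1,\dots,m\}$ and $\sigma\in\mathcal S^n_{|P|}$, define $\mathrm{Tr}^P_\sigma(M_1,\dots,M_m)=\mathrm{Tr}_\sigma(M_{p_1},\dots,M_{p_{|P|}})$ for $(M_1,\dots,M_m)\in\mathrm{End}(V)^{\oplus m}$. *)

theory Defs
  imports "Jordan_Normal_Form.Determinant" "HOL-Combinatorics.Cycles"
begin

section \<open>Endomorphisms of a tensor product\<close>

text \<open>
  We take \<open>V\<^sub>i = k\<^bsup>d i\<^esup>\<close> for \<open>i \<in> {1..n}\<close>. The tensor product \<open>V\<close> has as basis the tensors of standard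
  basis vectors, which are labelled by multi-indices, and an endomorphism of \<open>V\<close> is given by its
  matrix in this basis: a function on pairs (row, column) of multi-indices, \<open>undefined\<close> elsewhere.
\<close>

definition multi_indices :: "nat \<Rightarrow> (nat \<Rightarrow> nat) \<Rightarrow> (nat \<Rightarrow> nat) set" where
  "multi_indices n d = (\<Pi>\<^sub>E i\<in>{1..n}. {..<d i})"

type_synonym 'k tensor_mat = "(nat \<Rightarrow> nat) \<times> (nat \<Rightarrow> nat) \<Rightarrow> 'k"

definition End_tensor :: "nat \<Rightarrow> (nat \<Rightarrow> nat) \<Rightarrow> 'k tensor_mat set" where
  "End_tensor n d = (multi_indices n d \<times> multi_indices n d) \<rightarrow>\<^sub>E UNIV"

text \<open>\<open>X\<^sub>1 \<otimes> \<dots> \<otimes> X\<^sub>n\<close>, that is, the Kronecker product of the matrices \<open>X\<^sub>i\<close>.\<close>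

definition simple_tensor ::
    "nat \<Rightarrow> (nat \<Rightarrow> nat) \<Rightarrow> (nat \<Rightarrow> 'k::field mat) \<Rightarrow> 'k tensor_mat" where
  "simple_tensor n d X =
     (\<lambda>(a, b)\<in>multi_indices n d \<times> multi_indices n d. \<Prod>i=1..n. X i $$ (a i, b i))"

definition tensor_mat_mult ::
    "nat \<Rightarrow> (nat \<Rightarrow> nat) \<Rightarrow> 'k::field tensor_mat \<Rightarrow> 'k tensor_mat \<Rightarrow> 'k tensor_mat" where
  "tensor_mat_mult n d A B =
     (\<lambda>(a, b)\<in>multi_indices n d \<times> multi_indices n d. \<Sum>c\<in>multi_indices n d. A (a, c) * B (c, b))"

section \<open>The action of the product of general linear groups\<close>

definition GL_prod :: "nat \<Rightarrow> (nat \<Rightarrow> nat) \<Rightarrow> (nat \<Rightarrow> 'k::field mat) set" where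
  "GL_prod n d = (\<Pi>\<^sub>E i\<in>{1..n}. Units (ring_mat TYPE('k) (d i) ()))"

definition tensor_conj ::
    "nat \<Rightarrow> (nat \<Rightarrow> nat) \<Rightarrow> (nat \<Rightarrow> 'k::field mat) \<Rightarrow> 'k tensor_mat \<Rightarrow> 'k tensor_mat" where
  "tensor_conj n d g A =
     tensor_mat_mult n d (tensor_mat_mult n d (simple_tensor n d g) A)
       (simple_tensor n d (\<lambda>i. inv\<^bsub>ring_mat TYPE('k) (d i) ()\<^esub> (g i)))"

definition End_power :: "nat \<Rightarrow> (nat \<Rightarrow> nat) \<Rightarrow> nat \<Rightarrow> (nat \<Rightarrow> 'k tensor_mat) set" where
  "End_power n d m = {1..m} \<rightarrow>\<^sub>E End_tensor n d"

definition simultaneous_conj ::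
    "nat \<Rightarrow> (nat \<Rightarrow> nat) \<Rightarrow> nat \<Rightarrow> (nat \<Rightarrow> 'k::field mat) \<Rightarrow> (nat \<Rightarrow> 'k tensor_mat) \<Rightarrow> nat \<Rightarrow> 'k tensor_mat"
  where "simultaneous_conj n d m g M = (\<lambda>p\<in>{1..m}. tensor_conj n d g (M p))"

section \<open>Polynomial functions and invariants\<close>

text \<open>
  The unital \<open>k\<close>-algebra generated by \<open>S\<close>, inside the algebra of \<open>k\<close>-valued functions on \<open>W\<close>.
  Functions on \<open>W\<close> are represented extensionally, so that equality means equality on \<open>W\<close>.
\<close>

inductive_set algebra_generated :: "'w set \<Rightarrow> ('w \<Rightarrow> 'k::field) set \<Rightarrow> ('w \<Rightarrow> 'k) set"
  for W :: "'w set" and S :: "('w \<Rightarrow> 'k) set" where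
  const: "(\<lambda>w\<in>W. c) \<in> algebra_generated W S"
| gen: "f \<in> S \<Longrightarrow> restrict f W \<in> algebra_generated W S"
| add: "f \<in> algebra_generated W S \<Longrightarrow> h \<in> algebra_generated W S \<Longrightarrow>
    (\<lambda>w\<in>W. f w + h w) \<in> algebra_generated W S"
| mult: "f \<in> algebra_generated W S \<Longrightarrow> h \<in> algebra_generated W S \<Longrightarrow>
    (\<lambda>w\<in>W. f w * h w) \<in> algebra_generated W S"

definition polynomial_functions ::
    "nat \<Rightarrow> (nat \<Rightarrow> nat) \<Rightarrow> nat \<Rightarrow> ((nat \<Rightarrow> 'k::field tensor_mat) \<Rightarrow> 'k) set" where
  "polynomial_functions n d m = algebra_generated (End_power n d m)
     {\<lambda>M. M p (a, b) | p a b. p \<in> {1..m} \<and> a \<in> multi_indices n d \<and> b \<in> multi_indices n d}"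

definition invariant_ring ::
    "nat \<Rightarrow> (nat \<Rightarrow> nat) \<Rightarrow> nat \<Rightarrow> ((nat \<Rightarrow> 'k::field tensor_mat) \<Rightarrow> 'k) set" where
  "invariant_ring n d m = {f \<in> polynomial_functions n d m.
     \<forall>g\<in>GL_prod n d. \<forall>M\<in>End_power n d m. f (simultaneous_conj n d m g M) = f M}"

section \<open>The trace functions\<close>

definition mat_trace :: "'k::field mat \<Rightarrow> 'k" where
  "mat_trace A = sum_list (diag_mat A)"

text \<open>
  The disjoint cycles of a permutation of \<open>{1..l}\<close>, fixed points included. Each cycle is the list
  \<open>x, \<pi> x, \<pi> (\<pi> x), \<dots>\<close>, written once, beginning with its least element.
\<close>

definition disjoint_cycles :: "nat \<Rightarrow> (nat \<Rightarrow> nat) \<Rightarrow> nat list set" where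
  "disjoint_cycles l \<pi> = support \<pi> ` {x \<in> {1..l}. \<forall>y\<in>set (support \<pi> x). x \<le> y}"

definition cycle_trace ::
    "nat \<Rightarrow> nat \<Rightarrow> (nat \<Rightarrow> nat) \<Rightarrow> (nat \<Rightarrow> 'k::field mat) \<Rightarrow> 'k" where
  "cycle_trace r l \<pi> M =
     (\<Prod>c\<in>disjoint_cycles l \<pi>. mat_trace (foldr (\<lambda>j B. M j * B) c (1\<^sub>m r)))"

definition matrix_unit :: "nat \<Rightarrow> nat \<times> nat \<Rightarrow> 'k::field mat" where
  "matrix_unit r s = mat r r (\<lambda>t. if t = s then 1 else 0)"

text \<open>
  The multilinear extension of the product of the \<open>T\<^bsub>\<sigma> i\<^esub>\<close>: every argument is expanded in the basis of
  \<open>End(V)\<close> formed by the simple tensors of matrix units. \<open>R j = (a, b)\<close> selects in the \<open>j\<close>-th argument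
  the basis element that is the tensor product of the matrix units at \<open>(a i, b i)\<close>.
  The lemmas at the end of the theory confirm that this function is multilinear and has the
  prescribed values on all tuples of simple tensors.
\<close>

definition tensor_trace ::
    "nat \<Rightarrow> (nat \<Rightarrow> nat) \<Rightarrow> nat \<Rightarrow> (nat \<Rightarrow> nat \<Rightarrow> nat) \<Rightarrow> (nat \<Rightarrow> 'k::field tensor_mat) \<Rightarrow> 'k" where
  "tensor_trace n d l \<sigma> A =
     (\<Sum>R\<in>{1..l} \<rightarrow>\<^sub>E multi_indices n d \<times> multi_indices n d. (\<Prod>j=1..l. A j (R j)) *
        (\<Prod>i=1..n. cycle_trace (d i) l (\<sigma> i) (\<lambda>j. matrix_unit (d i) (fst (R j) i, snd (R j) i))))"

text \<open>Entries of vectors are numbered from 1, positions in lists from 0.\<close>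

definition tensor_trace_word ::
    "nat \<Rightarrow> (nat \<Rightarrow> nat) \<Rightarrow> nat list \<Rightarrow> (nat \<Rightarrow> nat \<Rightarrow> nat) \<Rightarrow> (nat \<Rightarrow> 'k::field tensor_mat) \<Rightarrow> 'k" where
  "tensor_trace_word n d P \<sigma> M = tensor_trace n d (length P) \<sigma> (\<lambda>j. M (P ! (j - 1)))"

section \<open>Characterization of the multilinear extension\<close>

lemma tensor_trace_multilinear:
  assumes j: "j \<in> {1..l}"
  shows "tensor_trace n d l \<sigma>
      (A(j := (\<lambda>t\<in>multi_indices n d \<times> multi_indices n d. x * B t + y * C t))) =
    x * tensor_trace n d l \<sigma> (A(j := B)) + y * tensor_trace n d l \<sigma> (A(j := C))"
proof -
  let ?I = "multi_indices n d \<times> multi_indices n d"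
  let ?D = "\<lambda>t\<in>?I. x * B t + y * C t"
  have split: "(\<Prod>i=1..l. (A(j := Z)) i (R i)) = Z (R j) * (\<Prod>i\<in>{1..l} - {j}. A i (R i))"
    for Z R using j by (simp add: prod.remove[of _ j])
  have "(\<Prod>i=1..l. (A(j := ?D)) i (R i)) =
      x * (\<Prod>i=1..l. (A(j := B)) i (R i)) + y * (\<Prod>i=1..l. (A(j := C)) i (R i))"
    if "R \<in> {1..l} \<rightarrow>\<^sub>E ?I" for R
  proof -
    have "R j \<in> ?I" using that j by (rule PiE_mem)
    then show ?thesis unfolding split by (simp add: algebra_simps)
  qed
  then show ?thesis
    unfolding tensor_trace_def by (simp add: sum_distrib_left sum.distrib algebra_simps)
qed

lemma disjoint_cycles_unique:
  assumes \<pi>: "\<pi> permutes {1..l}" and j: "j \<in> {1..l}"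
  shows "\<exists>!c. c \<in> disjoint_cycles l \<pi> \<and> j \<in> set c"
proof -
  have perm: "permutation \<pi>" using \<pi> unfolding permutation_permutes by blast
  have self: "x \<in> set (support \<pi> x)" for x
    using least_power_of_permutation(2)[OF perm, of x] by force
  have eq: "set (support \<pi> x) = set (support \<pi> y)" if "y \<in> set (support \<pi> x)" for x y
  proof (rule ccontr)
    assume "set (support \<pi> x) \<noteq> set (support \<pi> y)"
    then have "set (support \<pi> x) \<inter> set (support \<pi> y) = {}"
      by (intro disjointD[OF disjoint_support[OF perm]] rangeI)
    then show False using IntI[OF that self[of y]] by (metis empty_iff)
  qed
  define x where "x = Min (set (support \<pi> j))"
  have ne: "set (support \<pi> j) \<noteq> {}" using self[of j] by (metis empty_iff)
  have x: "x \<in> set (support \<pi> j)" unfolding x_def by (rule Min_in[OF _ ne]) simp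
  have sx: "set (support \<pi> x) = set (support \<pi> j)" using eq[OF x] by simp
  have "x \<in> {1..l}"
  proof -
    obtain i where "x = (\<pi> ^^ i) j" using x by auto
    then show ?thesis using permutes_in_image[OF permutes_funpow[OF \<pi>]] j by metis
  qed
  moreover have least: "\<forall>y\<in>set (support \<pi> x). x \<le> y"
    unfolding sx unfolding x_def by (intro ballI Min_le List.finite_set)
  ultimately have ex: "support \<pi> x \<in> disjoint_cycles l \<pi>"
    unfolding disjoint_cycles_def by (intro imageI CollectI conjI)
  have jx: "j \<in> set (support \<pi> x)" unfolding sx by (rule self)
  show ?thesis
  proof (rule ex1I[of _ "support \<pi> x"])
    show "support \<pi> x \<in> disjoint_cycles l \<pi> \<and> j \<in> set (support \<pi> x)"
      by (rule conjI[OF ex jx])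
  next
    fix c assume c: "c \<in> disjoint_cycles l \<pi> \<and> j \<in> set c"
    then obtain z where z: "c = support \<pi> z" "\<forall>y\<in>set (support \<pi> z). z \<le> y"
      unfolding disjoint_cycles_def by (elim conjE imageE CollectE) iprover
    have "j \<in> set (support \<pi> z)" using c unfolding z(1) by (rule conjunct2)
    then have sz: "set (support \<pi> z) = set (support \<pi> x)"
      unfolding sx by (rule eq)
    have "z \<le> x" using z(2) unfolding sz by (rule bspec[OF _ self])
    moreover have "x \<le> z" using least unfolding sz[symmetric] by (rule bspec[OF _ self])
    ultimately have "z = x" by (rule antisym)
    then show "c = support \<pi> x" unfolding z(1) by (rule arg_cong)
  qed
qed

lemma disjoint_cycles_distinct:
  assumes "\<pi> permutes {1..l}" and "c \<in> disjoint_cycles l \<pi>"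
  shows "distinct c"
proof -
  have "permutation \<pi>" using assms(1) unfolding permutation_permutes by blast
  then have "distinct (support \<pi> x)" for x by (rule cycle_of_permutation)
  then show ?thesis using assms(2) unfolding disjoint_cycles_def by blast
qed

lemma finite_disjoint_cycles: "finite (disjoint_cycles l \<pi>)"
  unfolding disjoint_cycles_def by simp

lemma disjoint_cycles_subset:
  assumes \<pi>: "\<pi> permutes {1..l}" and "c \<in> disjoint_cycles l \<pi>"
  shows "set c \<subseteq> {1..l}"
proof -
  obtain x where x: "x \<in> {1..l}" "c = support \<pi> x"
    using assms(2) unfolding disjoint_cycles_def by blast
  have "(\<pi> ^^ i) x \<in> {1..l}" for i
    using permutes_in_image[OF permutes_funpow[OF \<pi>]] x(1) by metis
  then show ?thesis unfolding x(2) by auto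
qed

lemma foldr_mat_carrier:
  fixes M :: "nat \<Rightarrow> 'k::field mat"
  assumes "\<And>j. j \<in> set c \<Longrightarrow> M j \<in> carrier_mat r r" and "B \<in> carrier_mat r r"
  shows "foldr (\<lambda>j B. M j * B) c B \<in> carrier_mat r r"
  using assms by (induction c) (auto intro: mult_carrier_mat)

lemma foldr_mat_append:
  fixes M :: "nat \<Rightarrow> 'k::field mat"
  assumes "\<And>j. j \<in> set c \<Longrightarrow> M j \<in> carrier_mat r r" and "B \<in> carrier_mat r r"
  shows "foldr (\<lambda>j B. M j * B) c B = foldr (\<lambda>j B. M j * B) c (1\<^sub>m r) * B"
  using assms
proof (induction c)
  case (Cons j c)
  have 1: "foldr (\<lambda>j B. M j * B) c (1\<^sub>m r) \<in> carrier_mat r r"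
    using Cons.prems by (intro foldr_mat_carrier) auto
  then show ?case using Cons by (simp add: assoc_mult_mat[of _ r r _ r _ r])
qed (simp add: left_mult_one_mat[of B r r])

lemma mat_trace_triple:
  fixes A N B :: "'k::field mat"
  assumes "A \<in> carrier_mat r r" "N \<in> carrier_mat r r" "B \<in> carrier_mat r r"
  shows "mat_trace (A * (N * B)) =
    (\<Sum>s\<in>{..<r} \<times> {..<r}. N $$ s * (\<Sum>p<r. A $$ (p, fst s) * B $$ (snd s, p)))"
proof -
  have "mat_trace (A * (N * B)) =
      (\<Sum>p<r. \<Sum>x<r. A $$ (p, x) * (\<Sum>y<r. N $$ (x, y) * B $$ (y, p)))"
    using assms unfolding mat_trace_def diag_mat_def
    by (simp add: interv_sum_list_conv_sum_set_nat scalar_prod_def lessThan_atLeast0)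
  also have "\<dots> = (\<Sum>p<r. \<Sum>s\<in>{..<r} \<times> {..<r}. N $$ s * (A $$ (p, fst s) * B $$ (snd s, p)))"
    by (simp add: sum.cartesian_product' sum_distrib_left mult_ac)
  also have "\<dots> = (\<Sum>s\<in>{..<r} \<times> {..<r}. \<Sum>p<r. N $$ s * (A $$ (p, fst s) * B $$ (snd s, p)))"
    by (rule sum.swap)
  finally show ?thesis by (simp add: sum_distrib_left)
qed

lemma matrix_unit_carrier [simp]: "matrix_unit r s \<in> carrier_mat r r"
  unfolding matrix_unit_def by simp

lemma mat_trace_triple_unit:
  fixes A N B :: "'k::field mat"
  assumes "A \<in> carrier_mat r r" "N \<in> carrier_mat r r" "B \<in> carrier_mat r r"
  shows "mat_trace (A * (N * B)) =
    (\<Sum>s\<in>{..<r} \<times> {..<r}. N $$ s * mat_trace (A * (matrix_unit r s * B)))"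
proof -
  have "mat_trace (A * (matrix_unit r s * B)) = (\<Sum>p<r. A $$ (p, fst s) * B $$ (snd s, p))"
    if s: "s \<in> {..<r} \<times> {..<r}" for s
  proof -
    have "mat_trace (A * (matrix_unit r s * B)) =
      (\<Sum>t\<in>{..<r} \<times> {..<r}. if t = s then (\<Sum>p<r. A $$ (p, fst t) * B $$ (snd t, p)) else 0)"
      by (subst mat_trace_triple[OF assms(1) matrix_unit_carrier assms(3)], intro sum.cong refl)
        (auto simp: matrix_unit_def)
    then show ?thesis using s by simp
  qed
  then show ?thesis unfolding mat_trace_triple[OF assms] by (intro sum.cong refl) simp
qed

lemma cycle_trace_slot:
  fixes M :: "nat \<Rightarrow> 'k::field mat"
  assumes \<pi>: "\<pi> permutes {1..l}" and j: "j \<in> {1..l}"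
    and M: "\<And>i. i \<in> {1..l} \<Longrightarrow> M i \<in> carrier_mat r r"
  shows "cycle_trace r l \<pi> M =
    (\<Sum>s\<in>{..<r} \<times> {..<r}. M j $$ s * cycle_trace r l \<pi> (M(j := matrix_unit r s)))"
proof -
  let ?F = "\<lambda>M c. mat_trace (foldr (\<lambda>j B. M j * B) c (1\<^sub>m r))"
  obtain c where c: "c \<in> disjoint_cycles l \<pi>" "j \<in> set c"
    and un: "\<And>c'. c' \<in> disjoint_cycles l \<pi> \<Longrightarrow> j \<in> set c' \<Longrightarrow> c' = c"
    using disjoint_cycles_unique[OF \<pi> j] by blast
  obtain us vs where c_eq: "c = us @ j # vs" using c(2) by (meson split_list)
  have nj: "j \<notin> set us" "j \<notin> set vs"
    using disjoint_cycles_distinct[OF \<pi> c(1)] unfolding c_eq by auto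
  have car: "M i \<in> carrier_mat r r" if "i \<in> set us \<union> set vs" for i
    using disjoint_cycles_subset[OF \<pi> c(1)] that M unfolding c_eq by auto
  define U where "U = foldr (\<lambda>j B. M j * B) us (1\<^sub>m r)"
  define B where "B = foldr (\<lambda>j B. M j * B) vs (1\<^sub>m r)"
  have UB: "U \<in> carrier_mat r r" "B \<in> carrier_mat r r"
    unfolding U_def B_def using car by (auto intro!: foldr_mat_carrier)
  have Fc: "?F (M(j := N)) c = mat_trace (U * (N * B))" if N: "N \<in> carrier_mat r r" for N
  proof -
    have 1: "foldr (\<lambda>i B. (M(j := N)) i * B) vs (1\<^sub>m r) = B"
      unfolding B_def using nj by (intro foldr_cong) auto
    have 2: "foldr (\<lambda>i B. (M(j := N)) i * B) us (N * B) = foldr (\<lambda>i B. M i * B) us (N * B)"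
      using nj by (intro foldr_cong) auto
    have 3: "foldr (\<lambda>i B. M i * B) us (N * B) = U * (N * B)"
      unfolding U_def using car UB N by (intro foldr_mat_append) auto
    show ?thesis unfolding c_eq foldr_append foldr.simps comp_def 1 using 2 3 by simp
  qed
  define Q where "Q = (\<Prod>c'\<in>disjoint_cycles l \<pi> - {c}. ?F M c')"
  have ct: "cycle_trace r l \<pi> (M(j := N)) = mat_trace (U * (N * B)) * Q"
    if N: "N \<in> carrier_mat r r" for N
  proof -
    have "?F (M(j := N)) c' = ?F M c'" if "c' \<in> disjoint_cycles l \<pi> - {c}" for c'
    proof -
      have "j \<notin> set c'" using un that by blast
      then have "foldr (\<lambda>i B. (M(j := N)) i * B) c' (1\<^sub>m r) = foldr (\<lambda>i B. M i * B) c' (1\<^sub>m r)"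
        by (intro foldr_cong) auto
      then show ?thesis by simp
    qed
    then have "(\<Prod>c'\<in>disjoint_cycles l \<pi> - {c}. ?F (M(j := N)) c') = Q"
      unfolding Q_def by (intro prod.cong) auto
    then show ?thesis unfolding cycle_trace_def
      using prod.remove[OF finite_disjoint_cycles c(1), of "?F (M(j := N))"] Fc[OF N] by simp
  qed
  have "cycle_trace r l \<pi> M = mat_trace (U * (M j * B)) * Q"
    using ct[OF M[OF j]] by simp
  then show ?thesis
    using mat_trace_triple_unit[OF UB(1) M[OF j] UB(2)]
    by (simp add: ct sum_distrib_right mult.assoc)
qed

lemma cycle_trace_expand_on:
  fixes M :: "nat \<Rightarrow> 'k::field mat"
  assumes \<pi>: "\<pi> permutes {1..l}" and L: "L \<subseteq> {1..l}"
    and M: "\<And>i. i \<in> {1..l} \<Longrightarrow> M i \<in> carrier_mat r r"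
  shows "cycle_trace r l \<pi> M =
    (\<Sum>S\<in>L \<rightarrow>\<^sub>E {..<r} \<times> {..<r}. (\<Prod>j\<in>L. M j $$ S j) *
       cycle_trace r l \<pi> (\<lambda>j. if j \<in> L then matrix_unit r (S j) else M j))"
proof -
  have "finite L" using L finite_subset by blast
  then show ?thesis using L
  proof (induction L rule: finite_induct)
    case (insert j L)
    let ?X = "{..<r} \<times> {..<r}"
    let ?N = "\<lambda>L S i. if i \<in> L then matrix_unit r (S i) else M i"
    let ?H = "\<lambda>S. (\<Prod>i\<in>insert j L. M i $$ S i) * cycle_trace r l \<pi> (?N (insert j L) S)"
    have step: "(\<Prod>i\<in>L. M i $$ S i) * cycle_trace r l \<pi> (?N L S) = (\<Sum>s\<in>?X. ?H (S(j := s)))" for S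
    proof -
      have "cycle_trace r l \<pi> (?N L S) =
          (\<Sum>s\<in>?X. ?N L S j $$ s * cycle_trace r l \<pi> ((?N L S)(j := matrix_unit r s)))"
        using insert.prems M by (intro cycle_trace_slot[OF \<pi>]) auto
      moreover have "(?N L S)(j := matrix_unit r s) = ?N (insert j L) (S(j := s))" for s
        using insert.hyps by (auto simp: fun_eq_iff)
      moreover have "(\<Prod>i\<in>insert j L. M i $$ (S(j := s)) i) = M j $$ s * (\<Prod>i\<in>L. M i $$ S i)" for s
      proof -
        have "(\<Prod>i\<in>L. M i $$ (S(j := s)) i) = (\<Prod>i\<in>L. M i $$ S i)"
          using insert.hyps by (intro prod.cong) auto
        then show ?thesis using insert.hyps by simp
      qed
      ultimately show ?thesis using insert.hyps
        by (simp add: sum_distrib_left mult_ac del: fun_upd_apply)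
    qed
    have "cycle_trace r l \<pi> M = (\<Sum>S\<in>L \<rightarrow>\<^sub>E ?X. \<Sum>s\<in>?X. ?H (S(j := s)))"
      using insert.IH insert.prems step by simp
    also have "\<dots> = (\<Sum>(s, S)\<in>?X \<times> (L \<rightarrow>\<^sub>E ?X). ?H (S(j := s)))"
      by (subst sum.swap) (simp only: sum.cartesian_product)
    also have "\<dots> = (\<Sum>S\<in>insert j L \<rightarrow>\<^sub>E ?X. ?H S)"
      unfolding PiE_insert_eq using insert.hyps
      by (subst sum.reindex[OF inj_combinator]) (auto simp: case_prod_unfold)
    finally show ?case .
  qed simp
qed

lemma cycle_trace_cong:
  assumes "\<pi> permutes {1..l}" and "\<And>j. j \<in> {1..l} \<Longrightarrow> M j = N j"
  shows "cycle_trace r l \<pi> M = cycle_trace r l \<pi> N"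
  unfolding cycle_trace_def
proof (rule prod.cong[OF refl])
  fix c assume "c \<in> disjoint_cycles l \<pi>"
  then have "set c \<subseteq> {1..l}" by (rule disjoint_cycles_subset[OF assms(1)])
  then have "foldr (\<lambda>j B. M j * B) c (1\<^sub>m r) = foldr (\<lambda>j B. N j * B) c (1\<^sub>m r)"
    using assms(2) by (intro foldr_cong) auto
  then show "mat_trace (foldr (\<lambda>j B. M j * B) c (1\<^sub>m r)) =
    mat_trace (foldr (\<lambda>j B. N j * B) c (1\<^sub>m r))" by simp
qed

lemma cycle_trace_expand:
  fixes M :: "nat \<Rightarrow> 'k::field mat"
  assumes \<pi>: "\<pi> permutes {1..l}" and M: "\<And>i. i \<in> {1..l} \<Longrightarrow> M i \<in> carrier_mat r r"
  shows "cycle_trace r l \<pi> M =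
    (\<Sum>S\<in>{1..l} \<rightarrow>\<^sub>E {..<r} \<times> {..<r}. (\<Prod>j=1..l. M j $$ S j) *
       cycle_trace r l \<pi> (\<lambda>j. matrix_unit r (S j)))"
  by (subst cycle_trace_expand_on[OF \<pi> order_refl M], assumption,
      intro sum.cong refl arg_cong2[of _ _ _ _ times] cycle_trace_cong[OF \<pi>]) auto

theorem tensor_trace_simple_tensors:
  fixes X :: "nat \<Rightarrow> nat \<Rightarrow> 'k::field mat"
  assumes \<sigma>: "\<And>i. i \<in> {1..n} \<Longrightarrow> \<sigma> i permutes {1..l}"
    and X: "\<And>i j. i \<in> {1..n} \<Longrightarrow> j \<in> {1..l} \<Longrightarrow> X i j \<in> carrier_mat (d i) (d i)"
  shows "tensor_trace n d l \<sigma> (\<lambda>j. simple_tensor n d (\<lambda>i. X i j)) =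
    (\<Prod>i=1..n. cycle_trace (d i) l (\<sigma> i) (X i))"
proof -
  let ?I = "multi_indices n d"
  let ?A = "{1..l} \<rightarrow>\<^sub>E ?I \<times> ?I"
  let ?B = "\<Pi>\<^sub>E i\<in>{1..n}. {1..l} \<rightarrow>\<^sub>E {..<d i} \<times> {..<d i}"
  let ?G = "\<lambda>i S. (\<Prod>j=1..l. X i j $$ S j) * cycle_trace (d i) l (\<sigma> i) (\<lambda>j. matrix_unit (d i) (S j))"
  let ?f = "\<lambda>R. \<lambda>i\<in>{1..n}. \<lambda>j\<in>{1..l}. (fst (R j) i, snd (R j) i)"
  let ?h = "\<lambda>S. \<lambda>j\<in>{1..l}. (\<lambda>i\<in>{1..n}. fst (S i j), \<lambda>i\<in>{1..n}. snd (S i j))"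
  have "(\<Prod>i=1..n. cycle_trace (d i) l (\<sigma> i) (X i)) =
      (\<Prod>i=1..n. \<Sum>S\<in>{1..l} \<rightarrow>\<^sub>E {..<d i} \<times> {..<d i}. ?G i S)"
    by (intro prod.cong refl cycle_trace_expand \<sigma> X)
  also have "\<dots> = (\<Sum>S\<in>?B. \<Prod>i=1..n. ?G i (S i))"
    by (rule prod_sum_PiE) (auto intro!: finite_PiE)
  also have "\<dots> = tensor_trace n d l \<sigma> (\<lambda>j. simple_tensor n d (\<lambda>i. X i j))"
    unfolding tensor_trace_def
  proof (rule sum.reindex_bij_witness[where i = ?f and j = ?h])
    fix S assume S: "S \<in> ?B"
    have Sij: "S i j \<in> {..<d i} \<times> {..<d i}" if "i \<in> {1..n}" "j \<in> {1..l}" for i j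
      using PiE_mem[OF PiE_mem[OF S that(1)] that(2)] .
    show h: "?h S \<in> ?A"
      unfolding multi_indices_def using Sij by (fastforce simp: mem_Times_iff)
    show "?f (?h S) = S"
    proof
      fix i show "?f (?h S) i = S i"
      proof (cases "i \<in> {1..n}")
        case True
        then have "S i \<in> extensional {1..l}" using S by (auto simp: PiE_iff)
        then show ?thesis using True by (auto simp: fun_eq_iff extensional_def)
      next
        case False
        then show ?thesis using S by (auto simp: PiE_iff extensional_def)
      qed
    qed
    have "(\<Prod>j=1..l. simple_tensor n d (\<lambda>i. X i j) (?h S j)) = (\<Prod>j=1..l. \<Prod>i=1..n. X i j $$ S i j)"
    proof (rule prod.cong[OF refl])
      fix j assume j: "j \<in> {1..l}"
      have "?h S j \<in> ?I \<times> ?I" using PiE_mem[OF h j] .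
      then show "simple_tensor n d (\<lambda>i. X i j) (?h S j) = (\<Prod>i=1..n. X i j $$ S i j)"
        using j unfolding simple_tensor_def by (auto intro!: prod.cong)
    qed
    also have "\<dots> = (\<Prod>i=1..n. \<Prod>j=1..l. X i j $$ S i j)" by (rule prod.swap)
    finally have 1: "(\<Prod>j=1..l. simple_tensor n d (\<lambda>i. X i j) (?h S j)) = \<dots>" .
    have 2: "(\<Prod>i=1..n. cycle_trace (d i) l (\<sigma> i)
          (\<lambda>j. matrix_unit (d i) (fst (?h S j) i, snd (?h S j) i))) =
        (\<Prod>i=1..n. cycle_trace (d i) l (\<sigma> i) (\<lambda>j. matrix_unit (d i) (S i j)))"
      by (intro prod.cong refl cycle_trace_cong \<sigma>) auto
    show "(\<Prod>j=1..l. simple_tensor n d (\<lambda>i. X i j) (?h S j)) *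
        (\<Prod>i=1..n. cycle_trace (d i) l (\<sigma> i)
          (\<lambda>j. matrix_unit (d i) (fst (?h S j) i, snd (?h S j) i))) = (\<Prod>i=1..n. ?G i (S i))"
      unfolding 1 2 by (simp only: prod.distrib)
  next
    fix R assume R: "R \<in> ?A"
    have Rj: "R j \<in> ?I \<times> ?I" if "j \<in> {1..l}" for j using PiE_mem[OF R that] .
    show "?f R \<in> ?B"
      using Rj unfolding multi_indices_def by (fastforce simp: mem_Times_iff PiE_iff)
    show "?h (?f R) = R"
    proof
      fix j show "?h (?f R) j = R j"
      proof (cases "j \<in> {1..l}")
        case True
        then have "fst (R j) \<in> extensional {1..n}" "snd (R j) \<in> extensional {1..n}"
          using Rj[OF True] unfolding multi_indices_def by (auto simp: mem_Times_iff PiE_iff)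
        then have "(\<lambda>i\<in>{1..n}. fst (R j) i) = fst (R j)" "(\<lambda>i\<in>{1..n}. snd (R j) i) = snd (R j)"
          by (simp_all add: extensional_restrict)
        moreover have "?h (?f R) j = (\<lambda>i\<in>{1..n}. fst (R j) i, \<lambda>i\<in>{1..n}. snd (R j) i)"
          using True by (simp cong: restrict_cong)
        ultimately show ?thesis by simp
      next
        case False
        then show ?thesis using R by (auto simp: PiE_iff extensional_def)
      qed
    qed
  qed
  finally show ?thesis by simp
qed

end

theory Submission
  imports Defs "HOL-Library.Function_Algebras" "Jordan_Normal_Form.Char_Poly"
begin

text \<open>
  A multilinear function of \<open>l\<close> endomorphisms of \<open>V\<close> is a matrix \<open>F\<close> whose rows and columns are
  labelled by \<open>l\<close>-tuples of multi-indices: it sends \<open>(A\<^sub>1, \<dots>, A\<^sub>l)\<close> to the sum of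
  \<open>F a b * \<Prod>\<^sub>j A\<^sub>j (a\<^sub>j, b\<^sub>j)\<close> over all such tuples \<open>a, b\<close>. The group \<open>S\<^sub>l\<^sup>n\<close> permutes the \<open>l\<close> entries of a
  tuple, separately in each of the \<open>n\<close> components. A product of matrix units along a cycle has trace
  \<open>1\<close> if their indices match along the cycle and \<open>0\<close> otherwise, and this says that the matrix of
  \<open>Tr\<^sub>\<sigma>\<close> is the permutation matrix of \<open>\<sigma>\<close> (lemma \<open>tensor_trace_eq\<close>).

  A form is invariant under conjugation by \<open>g\<close> if and only if its matrix commutes with the
  transposed \<open>l\<close>-th tensor power of \<open>g\<^sub>1 \<otimes> \<dots> \<otimes> g\<^sub>n\<close> (\<open>slot_kernel\<close>). Permutation matrices commute
  with it, so the trace functions are invariant. For the converse let \<open>F\<close> commute with these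
  transposed tensor powers for all \<open>g\<close>. The entries of a tensor power are
  monomials in the entries of \<open>g\<^sub>1, \<dots>, g\<^sub>n\<close>, and two positions carry the same monomial exactly
  when \<open>S\<^sub>l\<^sup>n\<close> moves one to the other. A polynomial identity on the general linear groups holds for
  all matrices, and distinct monomials are linearly independent. So the identity splits into its
  coefficients, which say that \<open>F\<close> commutes with every matrix invariant under \<open>S\<^sub>l\<^sup>n\<close>
  (lemma \<open>commutes_with_invariant_kernels\<close>). By the double commutant theorem for a finite
  permutation group, \<open>F\<close> is then a linear combination of permutation matrices
  (\<open>bicommutant_permutation_group\<close>). This is Schur-Weyl duality for all tensor factors at once.

  It remains to pass from multilinear forms to polynomials. In characteristic zero a polynomial
  function can be written with coefficients, attached to words in the coordinates, that do not change
  when the letters of the word are permuted (\<open>polynomial_symmetric_normal_form\<close>), and such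
  coefficients are determined by the function. A letter is a triple of an argument number and a row
  and column index. If the argument numbers \<open>p\<^sub>1, \<dots>, p\<^sub>l\<close> are fixed, the coefficients form a matrix
  as above. Multiplying all arguments by \<open>g\<close>, on the left or on the right, acts on each of these
  matrices and preserves the symmetry. So an invariant polynomial has matrices that commute with all
  transposed tensor powers (\<open>symmetric_commutator_coeffs_eq_0\<close>), and each of them contributes a
  linear combination of the functions \<open>Tr\<^sub>\<sigma>\<^sup>P\<close> with \<open>P = (p\<^sub>1, \<dots>, p\<^sub>l)\<close>.
\<close>

section \<open>Independence of monomials\<close>

text \<open>
  Dedekind's argument: subtracting the relation at \<open>x\<close>, multiplied by \<open>\<psi> y\<close>, from the relation at
  \<open>y * x\<close> removes the character \<open>\<psi>\<close> and leaves a shorter relation with coefficients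
  \<open>c \<phi> * (\<phi> y - \<psi> y)\<close>.
\<close>

lemma distinct_characters_independent:
  fixes c :: "(('v \<Rightarrow> 'k) \<Rightarrow> 'k) \<Rightarrow> 'k::field"
  assumes "finite S"
    and mult: "\<And>\<chi> x y. \<chi> \<in> S \<Longrightarrow> \<chi> (\<lambda>v. x v * y v) = \<chi> x * \<chi> y"
    and one: "\<And>\<chi>. \<chi> \<in> S \<Longrightarrow> \<chi> (\<lambda>v. 1) = 1"
    and zero: "\<And>x. (\<Sum>\<chi>\<in>S. c \<chi> * \<chi> x) = 0"
  shows "\<forall>\<chi>\<in>S. c \<chi> = 0"
  using assms
proof (induction S arbitrary: c rule: finite_induct)
  case (insert \<psi> S)
  have cS: "c \<phi> = 0" if \<phi>: "\<phi> \<in> S" for \<phi>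
  proof -
    have "\<forall>\<phi>\<in>S. c \<phi> * (\<phi> y - \<psi> y) = 0" for y
    proof (rule insert.IH)
      fix x
      have "(\<Sum>\<phi>\<in>insert \<psi> S. c \<phi> * \<phi> (\<lambda>v. y v * x v)) - \<psi> y * (\<Sum>\<phi>\<in>insert \<psi> S. c \<phi> * \<phi> x) = 0"
        using insert.prems(3) by simp
      also have "(\<Sum>\<phi>\<in>insert \<psi> S. c \<phi> * \<phi> (\<lambda>v. y v * x v)) = (\<Sum>\<phi>\<in>insert \<psi> S. c \<phi> * (\<phi> y * \<phi> x))"
        using insert.prems(1) by (intro sum.cong) auto
      also have "\<dots> - \<psi> y * (\<Sum>\<phi>\<in>insert \<psi> S. c \<phi> * \<phi> x) = (\<Sum>\<phi>\<in>S. c \<phi> * (\<phi> y - \<psi> y) * \<phi> x)"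
        using insert.hyps by (simp add: algebra_simps sum_subtractf sum_distrib_left)
      finally show "(\<Sum>\<phi>\<in>S. c \<phi> * (\<phi> y - \<psi> y) * \<phi> x) = 0" .
    qed (use insert.prems in auto)
    moreover have "\<exists>y. \<phi> y \<noteq> \<psi> y" using \<phi> insert.hyps by (metis ext)
    ultimately show ?thesis using \<phi> by auto
  qed
  have "c \<psi> * \<psi> (\<lambda>v. 1) = 0"
    using insert.prems(3)[of "\<lambda>v. 1"] insert.hyps cS by simp
  then have "c \<psi> = 0" using insert.prems(2)[of \<psi>] by simp
  then show ?case using cS by simp
qed simp

text \<open>
  A monomial is a multiplicative character of the functions on its variables, so Dedekind's theorem
  applies to the monomial functions. Here \<open>u w\<close> lists the variables of the monomial labelled \<open>w\<close>,
  and different labels may carry the same monomial: only the sum of their coefficients vanishes.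
\<close>

lemma monomials_independent:
  fixes u :: "'w \<Rightarrow> 'j \<Rightarrow> 'v" and c :: "'w \<Rightarrow> 'k::field"
  assumes W: "finite W"
    and zero: "\<And>x. (\<Sum>w\<in>W. c w * (\<Prod>j\<in>J w. x (u w j))) = 0"
    and w: "w \<in> W"
  shows "(\<Sum>w' | w' \<in> W \<and> (\<forall>x :: 'v \<Rightarrow> 'k. (\<Prod>j\<in>J w'. x (u w' j)) = (\<Prod>j\<in>J w. x (u w j))). c w') = 0"
proof -
  define \<chi> where "\<chi> w = (\<lambda>x :: 'v \<Rightarrow> 'k. \<Prod>j\<in>J w. x (u w j))" for w
  define b where "b \<phi> = sum c {w' \<in> W. \<chi> w' = \<phi>}" for \<phi>
  have "\<forall>\<phi>\<in>\<chi> ` W. b \<phi> = 0"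
  proof (rule distinct_characters_independent)
    fix x
    have "(\<Sum>\<phi>\<in>\<chi> ` W. b \<phi> * \<phi> x) = (\<Sum>\<phi>\<in>\<chi> ` W. \<Sum>w' | w' \<in> W \<and> \<chi> w' = \<phi>. c w' * \<chi> w' x)"
      unfolding b_def sum_distrib_right by (intro sum.cong) auto
    also have "\<dots> = (\<Sum>w\<in>W. c w * \<chi> w x)"
      using W by (intro sum.group) auto
    finally show "(\<Sum>\<phi>\<in>\<chi> ` W. b \<phi> * \<phi> x) = 0" using zero by (simp add: \<chi>_def)
  qed (use W in \<open>auto simp: \<chi>_def prod.distrib\<close>)
  then have "b (\<chi> w) = 0" using w by simp
  then show ?thesis by (simp add: b_def \<chi>_def fun_eq_iff)
qed

text \<open>
  The weight \<open>h\<close> is constant on the labels that carry the same monomial, and their coefficients add up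
  to zero. In the proof that invariant matrices are in the commutant, the weights are the entries
  of the invariant matrix.
\<close>

lemma sum_constant_on_monomials_eq_0:
  fixes u :: "'w \<Rightarrow> 'j \<Rightarrow> 'v" and c h :: "'w \<Rightarrow> 'k::field"
  assumes W: "finite W"
    and zero: "\<And>x. (\<Sum>w\<in>W. c w * (\<Prod>j\<in>J w. x (u w j))) = 0"
    and h: "\<And>w w'. w \<in> W \<Longrightarrow> w' \<in> W \<Longrightarrow>
      (\<forall>x :: 'v \<Rightarrow> 'k. (\<Prod>j\<in>J w. x (u w j)) = (\<Prod>j\<in>J w'. x (u w' j))) \<Longrightarrow> h w = h w'"
  shows "(\<Sum>w\<in>W. c w * h w) = 0"
proof -
  define \<chi> where "\<chi> w = (\<lambda>x :: 'v \<Rightarrow> 'k. \<Prod>j\<in>J w. x (u w j))" for w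
  have "(\<Sum>w\<in>W. c w * h w) = (\<Sum>\<phi>\<in>\<chi> ` W. \<Sum>w | w \<in> W \<and> \<chi> w = \<phi>. c w * h w)"
    using W by (intro sum.group[symmetric]) auto
  also have "\<dots> = 0"
  proof (rule sum.neutral, rule ballI)
    fix \<phi> assume "\<phi> \<in> \<chi> ` W"
    then obtain w where w: "w \<in> W" "\<phi> = \<chi> w" by auto
    have "(\<Sum>w' | w' \<in> W \<and> \<chi> w' = \<chi> w. c w' * h w') = (\<Sum>w' | w' \<in> W \<and> \<chi> w' = \<chi> w. c w' * h w)"
    proof (rule sum.cong[OF refl])
      fix w' assume "w' \<in> {w' \<in> W. \<chi> w' = \<chi> w}"
      then have "w' \<in> W" "\<chi> w' = \<chi> w" by simp_all
      then have "h w' = h w"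
        using h[OF _ w(1), of w'] unfolding \<chi>_def fun_eq_iff by blast
      then show "c w' * h w' = c w' * h w" by simp
    qed
    also have "\<dots> = (\<Sum>w' | w' \<in> W \<and> \<chi> w' = \<chi> w. c w') * h w" by (simp add: sum_distrib_right)
    also have "\<dots> = 0"
      using monomials_independent[where u = u and J = J and c = c, OF W zero w(1)] by (simp add: \<chi>_def fun_eq_iff)
    finally show "(\<Sum>w | w \<in> W \<and> \<chi> w = \<phi>. c w * h w) = 0" using w(2) by simp
  qed
  finally show ?thesis .
qed

text \<open>
  Giving the variables in \<open>A\<close> the value \<open>2\<close> and all others the value \<open>1\<close> turns a monomial into a
  power of \<open>2\<close>, whose exponent is recovered in characteristic zero.
\<close>

lemma monomial_eq_imp_card_eq:
  assumes eq: "\<And>x :: 'v \<Rightarrow> 'k::field_char_0. (\<Prod>j\<in>J. x (u j)) = (\<Prod>j\<in>J'. x (u' j))"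
    and fin: "finite J" "finite J'"
  shows "card {j \<in> J. u j \<in> A} = card {j \<in> J'. u' j \<in> A}"
proof -
  have *: "(\<Prod>j\<in>K. if h j \<in> A then 2 else (1 :: 'k)) = 2 ^ card {j \<in> K. h j \<in> A}"
    if "finite K" for K and h :: "_ \<Rightarrow> 'v"
    using that by (simp add: prod.If_cases Int_def)
  have "(of_nat (2 ^ card {j \<in> J. u j \<in> A}) :: 'k) = of_nat (2 ^ card {j \<in> J'. u' j \<in> A})"
    using eq[of "\<lambda>v. if v \<in> A then 2 else 1"] by (simp add: * fin)
  then have "(2 :: nat) ^ card {j \<in> J. u j \<in> A} = 2 ^ card {j \<in> J'. u' j \<in> A}"
    by (simp only: of_nat_eq_iff)
  then show ?thesis by simp
qed

lemma same_fibre_cards_imp_permutes: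
  assumes J: "finite J" and "\<And>v. card {j \<in> J. u j = v} = card {j \<in> J. u' j = v}"
  obtains \<pi> where "\<pi> permutes J" "\<And>j. j \<in> J \<Longrightarrow> u j = u' (\<pi> j)"
proof -
  have "image_mset u (mset_set J) = image_mset u' (mset_set J)"
    using assms by (intro multiset_eqI) (simp add: count_image_mset' eq_commute[of _ "u _"] eq_commute[of _ "u' _"])
  then show ?thesis using image_mset_eq_implies_permutes[OF J] that by metis
qed

section \<open>The double commutant of a permutation group\<close>

lemma sum_fun_apply: "sum f S x = (\<Sum>s\<in>S. f s x)" for f :: "'s \<Rightarrow> 'a \<Rightarrow> 'b::comm_monoid_add"
  by (induction S rule: infinite_finite_induct) auto

text \<open>
  Let \<open>A\<close> be the span of the permutation matrices \<open>P \<gamma>\<close>, and let \<open>tr \<gamma>\<close> be left multiplication by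
  a permutation matrix. As in Maschke's theorem, averaging a linear projection onto \<open>A\<close> over \<open>\<Gamma>\<close>
  gives a projection \<open>q\<close> onto \<open>A\<close> that commutes with all \<open>tr \<gamma>\<close>. The matrices \<open>C y y0\<close>
  that describe how the column \<open>y\<close> of \<open>q Z\<close> depends on the column \<open>y0\<close> of \<open>Z\<close> are then
  invariant under \<open>\<Gamma>\<close>. A matrix \<open>F\<close> that commutes with all of them satisfies
  \<open>q F = F * q 1 = F\<close>, because the identity matrix is in \<open>A\<close>; so \<open>F\<close> itself is in \<open>A\<close>.
\<close>

theorem bicommutant_permutation_group:
  fixes F :: "'x \<Rightarrow> 'x \<Rightarrow> 'k::field_char_0"
  assumes X: "finite X"
    and perm: "\<And>\<gamma>. \<gamma> \<in> \<Gamma> \<Longrightarrow> \<gamma> permutes X"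
    and id: "id \<in> \<Gamma>"
    and comp: "\<And>\<gamma> \<delta>. \<gamma> \<in> \<Gamma> \<Longrightarrow> \<delta> \<in> \<Gamma> \<Longrightarrow> \<gamma> \<circ> \<delta> \<in> \<Gamma>"
    and inv: "\<And>\<gamma>. \<gamma> \<in> \<Gamma> \<Longrightarrow> Hilbert_Choice.inv \<gamma> \<in> \<Gamma>"
    and commute: "\<And>C x y. (\<And>\<gamma> x y. \<gamma> \<in> \<Gamma> \<Longrightarrow> x \<in> X \<Longrightarrow> y \<in> X \<Longrightarrow> C (\<gamma> x) (\<gamma> y) = C x y) \<Longrightarrow>
        x \<in> X \<Longrightarrow> y \<in> X \<Longrightarrow> (\<Sum>z\<in>X. C x z * F z y) = (\<Sum>z\<in>X. F x z * C z y)"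
  obtains c where "\<And>x y. x \<in> X \<Longrightarrow> y \<in> X \<Longrightarrow> F x y = (\<Sum>\<gamma>\<in>\<Gamma>. c \<gamma> * of_bool (y = \<gamma> x))"
proof -
  have \<Gamma>: "finite \<Gamma>" using finite_subset[OF _ finite_permutations[OF X]] perm by blast
  have mem: "\<gamma> x \<in> X \<longleftrightarrow> x \<in> X" if "\<gamma> \<in> \<Gamma>" for \<gamma> x
    using permutes_in_image[OF perm[OF that]] .
  define sc :: "'k \<Rightarrow> ('x \<times> 'x \<Rightarrow> 'k) \<Rightarrow> 'x \<times> 'x \<Rightarrow> 'k" where "sc k f = (\<lambda>z. k * f z)" for k f
  interpret vs: vector_space sc
    by unfold_locales (auto simp: sc_def fun_eq_iff algebra_simps)
  interpret vp: vector_space_pair sc sc ..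
  define P :: "('x \<Rightarrow> 'x) \<Rightarrow> 'x \<times> 'x \<Rightarrow> 'k" where
    "P \<gamma> = (\<lambda>(x, y). of_bool (x \<in> X \<and> y = \<gamma> x))" for \<gamma>
  define A where "A = {Z. \<exists>c. Z = (\<lambda>t. \<Sum>\<gamma>\<in>\<Gamma>. c \<gamma> * P \<gamma> t)}"
  define tr :: "('x \<Rightarrow> 'x) \<Rightarrow> ('x \<times> 'x \<Rightarrow> 'k) \<Rightarrow> 'x \<times> 'x \<Rightarrow> 'k" where
    "tr \<gamma> Z = (\<lambda>(x, y). Z (\<gamma> x, y))" for \<gamma> Z
  have A_sub: "vs.subspace A"
    unfolding vs.subspace_def
  proof (intro conjI ballI allI)
    show "0 \<in> A" unfolding A_def by (auto intro!: exI[of _ "\<lambda>_. 0"])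
  next
    fix Y Z assume "Y \<in> A" "Z \<in> A"
    then obtain c e where "Y = (\<lambda>t. \<Sum>\<gamma>\<in>\<Gamma>. c \<gamma> * P \<gamma> t)" "Z = (\<lambda>t. \<Sum>\<gamma>\<in>\<Gamma>. e \<gamma> * P \<gamma> t)"
      unfolding A_def by blast
    then show "Y + Z \<in> A" unfolding A_def
      by (auto intro!: exI[of _ "\<lambda>\<gamma>. c \<gamma> + e \<gamma>"] simp: fun_eq_iff algebra_simps sum.distrib)
  next
    fix k Z assume "Z \<in> A"
    then obtain e where "Z = (\<lambda>t. \<Sum>\<gamma>\<in>\<Gamma>. e \<gamma> * P \<gamma> t)"
      unfolding A_def by blast
    then show "sc k Z \<in> A" unfolding A_def sc_def
      by (auto intro!: exI[of _ "\<lambda>\<gamma>. k * e \<gamma>"] simp: fun_eq_iff sum_distrib_left mult.assoc)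
  qed
  have tr_P: "tr \<tau> (P \<gamma>) = P (\<gamma> \<circ> \<tau>)" if "\<tau> \<in> \<Gamma>" for \<tau> \<gamma>
    unfolding tr_def P_def using mem[OF that] by (auto simp: fun_eq_iff)
  have bij: "bij_betw (\<lambda>\<gamma>. \<gamma> \<circ> \<tau>) \<Gamma> \<Gamma>" "bij_betw (\<lambda>\<gamma>. \<tau> \<circ> \<gamma>) \<Gamma> \<Gamma>" if \<tau>: "\<tau> \<in> \<Gamma>" for \<tau>
  proof -
    note inv_o = permutes_inv_o[OF perm[OF \<tau>]]
    have it: "Hilbert_Choice.inv \<tau> \<in> \<Gamma>" by (rule inv[OF \<tau>])
    show "bij_betw (\<lambda>\<gamma>. \<gamma> \<circ> \<tau>) \<Gamma> \<Gamma>"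
      using comp[OF _ \<tau>] comp[OF _ it]
      by (intro bij_betw_byWitness[where f' = "\<lambda>\<gamma>. \<gamma> \<circ> Hilbert_Choice.inv \<tau>"])
        (auto simp only: comp_assoc inv_o comp_id)
    show "bij_betw (\<lambda>\<gamma>. \<tau> \<circ> \<gamma>) \<Gamma> \<Gamma>"
      using comp[OF \<tau>] comp[OF it]
      by (intro bij_betw_byWitness[where f' = "\<lambda>\<gamma>. Hilbert_Choice.inv \<tau> \<circ> \<gamma>"])
        (auto simp only: o_assoc inv_o id_comp)
  qed
  have tr_A: "tr \<tau> Z \<in> A" if \<tau>: "\<tau> \<in> \<Gamma>" and Z: "Z \<in> A" for \<tau> Z
  proof -
    obtain c where c: "Z = (\<lambda>t. \<Sum>\<gamma>\<in>\<Gamma>. c \<gamma> * P \<gamma> t)" using Z unfolding A_def by blast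
    have it: "Hilbert_Choice.inv \<tau> \<in> \<Gamma>" by (rule inv[OF \<tau>])
    have "tr \<tau> Z = (\<lambda>t. \<Sum>\<gamma>\<in>\<Gamma>. c \<gamma> * P (\<gamma> \<circ> \<tau>) t)"
      unfolding c tr_P[OF \<tau>, symmetric] by (simp add: tr_def fun_eq_iff)
    also have "\<dots> = (\<lambda>t. \<Sum>\<gamma>\<in>\<Gamma>. c (\<gamma> \<circ> Hilbert_Choice.inv \<tau>) * P \<gamma> t)"
    proof
      fix t
      show "(\<Sum>\<gamma>\<in>\<Gamma>. c \<gamma> * P (\<gamma> \<circ> \<tau>) t) = (\<Sum>\<gamma>\<in>\<Gamma>. c (\<gamma> \<circ> Hilbert_Choice.inv \<tau>) * P \<gamma> t)"
        using sum.reindex_bij_betw[OF bij(1)[OF it], of "\<lambda>\<gamma>. c \<gamma> * P (\<gamma> \<circ> \<tau>) t"]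
        by (simp add: o_assoc[symmetric] permutes_inv_o[OF perm[OF \<tau>]])
    qed
    finally show ?thesis unfolding A_def by (auto intro!: exI[of _ "\<lambda>\<gamma>. c (\<gamma> \<circ> Hilbert_Choice.inv \<tau>)"])
  qed
  obtain p where p: "range p \<subseteq> A" "Vector_Spaces.linear sc sc p" "\<And>Z. Z \<in> A \<Longrightarrow> p Z = Z"
    using vp.linear_exists_left_inverse_on[OF vs.linear_ident A_sub] by auto
  interpret p: Vector_Spaces.linear sc sc p by (rule p(2))
  \<comment> \<open>The average of \<open>p\<close> over the group; dividing by its order needs characteristic zero.\<close>
  define q where "q Z = (\<lambda>t. (\<Sum>\<gamma>\<in>\<Gamma>. tr (Hilbert_Choice.inv \<gamma>) (p (tr \<gamma> Z)) t) / of_nat (card \<Gamma>))" for Z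
  have card: "(of_nat (card \<Gamma>) :: 'k) \<noteq> 0" using \<Gamma> id by auto
  have q_A: "q Z \<in> A" for Z
  proof -
    have "(\<Sum>\<gamma>\<in>\<Gamma>. tr (Hilbert_Choice.inv \<gamma>) (p (tr \<gamma> Z))) \<in> A"
      using p(1) inv by (intro vs.subspace_sum[OF A_sub] tr_A) auto
    then have "sc (1 / of_nat (card \<Gamma>)) (\<Sum>\<gamma>\<in>\<Gamma>. tr (Hilbert_Choice.inv \<gamma>) (p (tr \<gamma> Z))) \<in> A"
      by (rule vs.subspace_scale[OF A_sub])
    moreover have "sc (1 / of_nat (card \<Gamma>)) (\<Sum>\<gamma>\<in>\<Gamma>. tr (Hilbert_Choice.inv \<gamma>) (p (tr \<gamma> Z))) = q Z"
      by (simp add: sc_def q_def fun_eq_iff sum_fun_apply)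
    ultimately show ?thesis by simp
  qed
  have tr_inv: "tr (Hilbert_Choice.inv \<gamma>) (tr \<gamma> Z) = Z" if "\<gamma> \<in> \<Gamma>" for \<gamma> Z
    unfolding tr_def using permutes_inverses[OF perm[OF that]] by auto
  have q_id: "q Z = Z" if Z: "Z \<in> A" for Z
    using card by (simp add: q_def p(3) tr_A Z tr_inv)
  have q_tr: "q (tr \<tau> Z) = tr \<tau> (q Z)" if \<tau>: "\<tau> \<in> \<Gamma>" for \<tau> Z
  proof
    fix t :: "'x \<times> 'x" obtain x y where t: "t = (x, y)" by fastforce
    have inv_comp: "Hilbert_Choice.inv \<gamma> x = Hilbert_Choice.inv (\<tau> \<circ> \<gamma>) (\<tau> x)" if "\<gamma> \<in> \<Gamma>" for \<gamma>
      using permutes_inverses(2)[OF perm[OF \<tau>]] permutes_bij[OF perm[OF \<tau>]] permutes_bij[OF perm[OF that]]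
      by (simp add: o_inv_distrib)
    have tr2: "tr \<gamma> (tr \<tau> Z) = tr (\<tau> \<circ> \<gamma>) Z" for \<gamma>
      by (auto simp: tr_def)
    have "(\<Sum>\<gamma>\<in>\<Gamma>. tr (Hilbert_Choice.inv \<gamma>) (p (tr \<gamma> (tr \<tau> Z))) t) =
       (\<Sum>\<gamma>\<in>\<Gamma>. p (tr (\<tau> \<circ> \<gamma>) Z) (Hilbert_Choice.inv (\<tau> \<circ> \<gamma>) (\<tau> x), y))"
      by (intro sum.cong) (simp_all add: tr2 t, simp_all add: tr_def inv_comp)
    also have "\<dots> = (\<Sum>\<gamma>\<in>\<Gamma>. p (tr \<gamma> Z) (Hilbert_Choice.inv \<gamma> (\<tau> x), y))"
      by (rule sum.reindex_bij_betw[OF bij(2)[OF \<tau>], of "\<lambda>\<gamma>. p (tr \<gamma> Z) (Hilbert_Choice.inv \<gamma> (\<tau> x), y)"])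
    finally show "q (tr \<tau> Z) t = tr \<tau> (q Z) t" by (simp add: q_def t tr_def)
  qed
  have q_sum: "q (\<lambda>t. \<Sum>s\<in>S. k s * Z s t) t = (\<Sum>s\<in>S. k s * q (Z s) t)"
    if "finite S" for S :: "'s set" and k Z t
  proof -
    have "p (tr \<gamma> (\<lambda>t. \<Sum>s\<in>S. k s * Z s t)) = (\<Sum>s\<in>S. sc (k s) (p (tr \<gamma> (Z s))))" for \<gamma>
    proof -
      have "tr \<gamma> (\<lambda>t. \<Sum>s\<in>S. k s * Z s t) = (\<Sum>s\<in>S. sc (k s) (tr \<gamma> (Z s)))"
        by (auto simp: tr_def sc_def fun_eq_iff sum_fun_apply)
      then show ?thesis by (simp add: p.sum p.scale)
    qed
    then have "tr (Hilbert_Choice.inv \<gamma>) (p (tr \<gamma> (\<lambda>t. \<Sum>s\<in>S. k s * Z s t))) t =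
        (\<Sum>s\<in>S. k s * tr (Hilbert_Choice.inv \<gamma>) (p (tr \<gamma> (Z s))) t)" for \<gamma>
      by (auto simp: tr_def sc_def sum_fun_apply split: prod.split)
    then show ?thesis
      by (simp add: q_def sum_divide_distrib sum_distrib_left) (rule sum.swap)
  qed
  define E :: "'x \<Rightarrow> 'x \<Rightarrow> 'x \<times> 'x \<Rightarrow> 'k" where "E x y = (\<lambda>t. of_bool (t = (x, y)))" for x y
  define C where "C y y0 = (\<lambda>x z. q (E z y0) (x, y))" for y y0
  have C_inv: "C y y0 (\<gamma> x) (\<gamma> z) = C y y0 x z" if \<gamma>: "\<gamma> \<in> \<Gamma>" for \<gamma> x y y0 z
  proof -
    have "tr \<gamma> (E (\<gamma> z) y0) = E z y0"
      using permutes_inj[OF perm[OF \<gamma>]] by (auto simp: tr_def E_def inj_eq fun_eq_iff)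
    then have "q (E z y0) = tr \<gamma> (q (E (\<gamma> z) y0))" using q_tr[OF \<gamma>] by metis
    then show ?thesis by (simp add: C_def tr_def)
  qed
  \<comment> \<open>Nothing is known about \<open>F\<close> outside \<open>X\<close>, whereas all members of \<open>A\<close> vanish there.\<close>
  define F' where "F' = (\<lambda>(x, y). if x \<in> X \<and> y \<in> X then F x y else 0)"
  define I where "I = (\<lambda>t. \<Sum>y\<in>X. 1 * E y y t)"
  have F'_eq: "F' = (\<lambda>t. \<Sum>s\<in>X \<times> X. F (fst s) (snd s) * E (fst s) (snd s) t)"
  proof
    fix t
    show "F' t = (\<Sum>s\<in>X \<times> X. F (fst s) (snd s) * E (fst s) (snd s) t)"
      using X by (cases t) (auto simp: E_def F'_def of_bool_def if_distrib[of "(*) _"] cong: if_cong)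
  qed
  have I: "I = P id"
    unfolding I_def P_def E_def using X by (auto simp: fun_eq_iff sum.neutral of_bool_def)
  have "P id = (\<lambda>t. \<Sum>\<gamma>\<in>\<Gamma>. of_bool (\<gamma> = id) * P \<gamma> t)"
    using \<Gamma> id by (intro ext) (simp add: of_bool_def if_distrib[of "\<lambda>x. x * _"] cong: if_cong)
  then have "P id \<in> A" unfolding A_def by (intro CollectI exI[of _ "\<lambda>\<gamma>. of_bool (\<gamma> = id)"])
  then have qI: "q I = P id" using q_id I by simp
  have "q F' (x, y) = F x y" if xy: "x \<in> X" "y \<in> X" for x y
  proof -
    have "q F' (x, y) = (\<Sum>s\<in>X \<times> X. F (fst s) (snd s) * C y (snd s) x (fst s))"
      unfolding F'_eq using X by (subst q_sum) (simp_all add: C_def)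
    also have "\<dots> = (\<Sum>z\<in>X. \<Sum>y0\<in>X. C y y0 x z * F z y0)"
      by (simp add: sum.cartesian_product' mult.commute)
    also have "\<dots> = (\<Sum>y0\<in>X. \<Sum>z\<in>X. C y y0 x z * F z y0)" by (rule sum.swap)
    also have "\<dots> = (\<Sum>y0\<in>X. \<Sum>z\<in>X. F x z * C y y0 z y0)"
      using xy by (intro sum.cong[OF refl] commute[where C = "C y _"] C_inv)
    also have "\<dots> = (\<Sum>z\<in>X. \<Sum>y0\<in>X. F x z * C y y0 z y0)" by (rule sum.swap)
    also have "\<dots> = (\<Sum>z\<in>X. F x z * q I (z, y))"
      unfolding I_def using X by (subst q_sum) (simp_all add: C_def sum_distrib_left)
    also have "\<dots> = F x y"
      unfolding qI P_def using X xy by (simp add: of_bool_def if_distrib[of "(*) _"] cong: if_cong conj_cong)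
    finally show ?thesis .
  qed
  moreover obtain c where "q F' = (\<lambda>t. \<Sum>\<gamma>\<in>\<Gamma>. c \<gamma> * P \<gamma> t)" using q_A unfolding A_def by blast
  ultimately have "F x y = (\<Sum>\<gamma>\<in>\<Gamma>. c \<gamma> * of_bool (y = \<gamma> x))" if "x \<in> X" "y \<in> X" for x y
    using that by (simp add: P_def)
  then show ?thesis by (rule that)
qed

section \<open>Trace functions in coordinates\<close>

lemma prod_of_bool:
  "finite S \<Longrightarrow> (\<Prod>s\<in>S. of_bool (P s)) = (of_bool (\<forall>s\<in>S. P s) :: 'a::comm_semiring_1)"
  by (induction S rule: finite_induct) auto

lemma matrix_unit_mult:
  assumes "q < r" "s < r"
  shows "matrix_unit r (p, q) * matrix_unit r (s, t) =
    (of_bool (q = s) :: 'k::field) \<cdot>\<^sub>m matrix_unit r (p, t)"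
proof (rule eq_matI)
  fix x y
  assume "x < dim_row (of_bool (q = s) \<cdot>\<^sub>m (matrix_unit r (p, t) :: 'k mat))"
    "y < dim_col (of_bool (q = s) \<cdot>\<^sub>m (matrix_unit r (p, t) :: 'k mat))"
  then have xy: "x < r" "y < r" by (simp_all add: matrix_unit_def)
  have "(matrix_unit r (p, q) * matrix_unit r (s, t)) $$ (x, y) =
      (\<Sum>z<r. (matrix_unit r (p, q) $$ (x, z) * matrix_unit r (s, t) $$ (z, y) :: 'k))"
    using xy by (simp add: matrix_unit_def scalar_prod_def lessThan_atLeast0)
  also have "\<dots> = (\<Sum>z<r. if z = q then of_bool (x = p \<and> q = s \<and> y = t) else 0)"
    using xy by (intro sum.cong) (auto simp: matrix_unit_def)
  finally have "(matrix_unit r (p, q) * matrix_unit r (s, t)) $$ (x, y) =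
      (\<Sum>z<r. (if z = q then of_bool (x = p \<and> q = s \<and> y = t) else 0 :: 'k))" .
  then show "(matrix_unit r (p, q) * matrix_unit r (s, t)) $$ (x, y) =
      ((of_bool (q = s) :: 'k) \<cdot>\<^sub>m matrix_unit r (p, t)) $$ (x, y)"
    using xy assms by (auto simp: matrix_unit_def)
qed (simp_all add: matrix_unit_def)

lemma mat_trace_smult_matrix_unit:
  assumes "p < r"
  shows "mat_trace (x \<cdot>\<^sub>m matrix_unit r (p, q)) = x * of_bool (p = q)"
proof -
  have "mat_trace (x \<cdot>\<^sub>m matrix_unit r (p, q)) = (\<Sum>z<r. (x \<cdot>\<^sub>m matrix_unit r (p, q)) $$ (z, z))"
    unfolding mat_trace_def diag_mat_def
    by (simp add: interv_sum_list_conv_sum_set_nat lessThan_atLeast0 matrix_unit_def)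
  also have "\<dots> = (\<Sum>z<r. if z = p then x * of_bool (p = q) else 0)"
    by (intro sum.cong) (auto simp: matrix_unit_def)
  finally have "mat_trace (x \<cdot>\<^sub>m matrix_unit r (p, q)) =
      (\<Sum>z<r. if z = p then x * of_bool (p = q) else 0)" .
  then show ?thesis using assms by simp
qed

text \<open>
  A product of matrix units vanishes unless each column index equals the next row index; then only
  the first row index and the last column index remain.
\<close>

lemma matrix_unit_path:
  fixes a b :: "nat \<Rightarrow> nat"
  assumes "\<And>j. j \<in> set c \<Longrightarrow> a j < r \<and> b j < r" and "c \<noteq> []"
  shows "foldr (\<lambda>j B. matrix_unit r (a j, b j) * B) c (1\<^sub>m r) =
    (of_bool (successively (\<lambda>x y. b x = a y) c) :: 'k::field) \<cdot>\<^sub>m matrix_unit r (a (hd c), b (last c))"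
  using assms
proof (induction c)
  case (Cons x c)
  show ?case
  proof (cases c)
    case Nil
    have "1 \<cdot>\<^sub>m M = M" for M :: "'k mat" by (intro eq_matI) auto
    with Nil show ?thesis by (simp add: right_mult_one_mat[OF matrix_unit_carrier])
  next
    case (Cons y c')
    have "foldr (\<lambda>j B. matrix_unit r (a j, b j) * B) (x # c) (1\<^sub>m r) =
        matrix_unit r (a x, b x) * ((of_bool (successively (\<lambda>x y. b x = a y) c) :: 'k) \<cdot>\<^sub>m
          matrix_unit r (a (hd c), b (last c)))"
      using Cons.IH Cons.prems Cons by simp
    also have "\<dots> = (of_bool (successively (\<lambda>x y. b x = a y) c) :: 'k) \<cdot>\<^sub>m
        (matrix_unit r (a x, b x) * matrix_unit r (a (hd c), b (last c)))"
      by (rule mult_smult_distrib[OF matrix_unit_carrier matrix_unit_carrier])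
    also have "\<dots> = (of_bool (successively (\<lambda>x y. b x = a y) c) :: 'k) \<cdot>\<^sub>m
        (of_bool (b x = a (hd c)) \<cdot>\<^sub>m matrix_unit r (a x, b (last c)))"
      using Cons.prems Cons by (subst matrix_unit_mult) auto
    finally show ?thesis using Cons
      by (auto simp: of_bool_def matrix_unit_def)
  qed
qed simp

text \<open>
  The list of a cycle runs through \<open>x, \<pi> x, \<pi> (\<pi> x), \<dots>\<close>, so the index conditions inside the product
  compare \<open>b j\<close> with \<open>a (\<pi> j)\<close> for all \<open>j\<close> but the last one, and the trace adds the condition for the
  last one, where \<open>\<pi>\<close> leads back to the start.
\<close>

lemma matrix_unit_cycle:
  assumes \<pi>: "\<pi> permutes {1..l}" and c: "c \<in> disjoint_cycles l \<pi>"
    and ab: "\<And>j. j \<in> {1..l} \<Longrightarrow> a j < r \<and> b j < r"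
  shows "mat_trace (foldr (\<lambda>j B. matrix_unit r (a j, b j) * B) c (1\<^sub>m r)) =
    (of_bool (\<forall>j\<in>set c. b j = a (\<pi> j)) :: 'k::field)"
proof -
  have perm: "permutation \<pi>" using \<pi> unfolding permutation_permutes by blast
  obtain x where x: "c = support \<pi> x" using c unfolding disjoint_cycles_def by blast
  define k where "k = least_power \<pi> x"
  have k: "(\<pi> ^^ k) x = x" "k > 0"
    using least_power_of_permutation[OF perm] unfolding k_def by auto
  obtain k' where k': "k = Suc k'" using k(2) by (cases k) auto
  have ne: "c \<noteq> []" and len: "length c = k" and nth: "\<And>i. i < k \<Longrightarrow> c ! i = (\<pi> ^^ i) x"
    using k(2) by (auto simp: x k_def)
  have set: "set c \<subseteq> {1..l}" by (rule disjoint_cycles_subset[OF \<pi> c])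
  have hd: "hd c = x" using nth[of 0] k(2) ne by (simp add: hd_conv_nth)
  have last: "last c = (\<pi> ^^ k') x" using nth[of k'] len ne k' by (simp add: last_conv_nth)
  have closes: "a (hd c) = a (\<pi> (last c))"
    using k(1) unfolding hd last k' by simp
  have "successively (\<lambda>x y. b x = a y) c \<and> b (last c) = a (hd c) \<longleftrightarrow>
      (\<forall>i<k'. b ((\<pi> ^^ i) x) = a (\<pi> ((\<pi> ^^ i) x))) \<and> b ((\<pi> ^^ k') x) = a (\<pi> ((\<pi> ^^ k') x))"
    unfolding successively_conv_nth closes using len last k' by (auto simp: nth)
  also have "\<dots> \<longleftrightarrow> (\<forall>i<k. b ((\<pi> ^^ i) x) = a (\<pi> ((\<pi> ^^ i) x)))"
    unfolding k' by (auto simp: less_Suc_eq)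
  also have "\<dots> \<longleftrightarrow> (\<forall>j\<in>set c. b j = a (\<pi> j))"
    unfolding x k_def by auto
  finally have *: "successively (\<lambda>x y. b x = a y) c \<and> b (last c) = a (hd c) \<longleftrightarrow>
    (\<forall>j\<in>set c. b j = a (\<pi> j))" .
  have "a (hd c) < r" using ab set hd_in_set[OF ne] by blast
  moreover have "foldr (\<lambda>j B. matrix_unit r (a j, b j) * B) c (1\<^sub>m r) =
    (of_bool (successively (\<lambda>x y. b x = a y) c) :: 'k) \<cdot>\<^sub>m matrix_unit r (a (hd c), b (last c))"
    using ab set ne by (intro matrix_unit_path) auto
  ultimately show ?thesis
    unfolding *[symmetric] by (simp add: mat_trace_smult_matrix_unit) auto
qed

lemma cycle_trace_matrix_units:
  assumes \<pi>: "\<pi> permutes {1..l}" and ab: "\<And>j. j \<in> {1..l} \<Longrightarrow> a j < r \<and> b j < r"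
  shows "cycle_trace r l \<pi> (\<lambda>j. matrix_unit r (a j, b j)) =
    (of_bool (\<forall>j\<in>{1..l}. b j = a (\<pi> j)) :: 'k::field)"
proof -
  have "cycle_trace r l \<pi> (\<lambda>j. matrix_unit r (a j, b j)) =
      (\<Prod>c\<in>disjoint_cycles l \<pi>. of_bool (\<forall>j\<in>set c. b j = a (\<pi> j)) :: 'k)"
    unfolding cycle_trace_def by (intro prod.cong[OF refl] matrix_unit_cycle[OF \<pi>] ab)
  also have "\<dots> = of_bool (\<forall>c\<in>disjoint_cycles l \<pi>. \<forall>j\<in>set c. b j = a (\<pi> j))"
    by (rule prod_of_bool[OF finite_disjoint_cycles])
  also have "(\<forall>c\<in>disjoint_cycles l \<pi>. \<forall>j\<in>set c. b j = a (\<pi> j)) \<longleftrightarrow> (\<forall>j\<in>{1..l}. b j = a (\<pi> j))"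
    using disjoint_cycles_unique[OF \<pi>] disjoint_cycles_subset[OF \<pi>] by blast
  finally show ?thesis .
qed

lemma finite_multi_indices: "finite (multi_indices n d)"
  unfolding multi_indices_def by (intro finite_PiE) auto

lemma sum_PiE_Times:
  "(\<Sum>R\<in>J \<rightarrow>\<^sub>E A \<times> B. h R) = (\<Sum>a\<in>J \<rightarrow>\<^sub>E A. \<Sum>b\<in>J \<rightarrow>\<^sub>E B. h (\<lambda>j\<in>J. (a j, b j)))"
proof -
  have "(\<Sum>R\<in>J \<rightarrow>\<^sub>E A \<times> B. h R) =
      (\<Sum>(a, b)\<in>(J \<rightarrow>\<^sub>E A) \<times> (J \<rightarrow>\<^sub>E B). h (\<lambda>j\<in>J. (a j, b j)))"
    by (rule sum.reindex_bij_witness[where i = "\<lambda>(a, b). \<lambda>j\<in>J. (a j, b j)"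
          and j = "\<lambda>R. (\<lambda>j\<in>J. fst (R j), \<lambda>j\<in>J. snd (R j))"])
      (auto simp: PiE_iff extensional_def fun_eq_iff mem_Times_iff intro!: arg_cong[where f = h])
  then show ?thesis by (simp add: sum.cartesian_product)
qed

abbreviation slot_tuples :: "nat \<Rightarrow> (nat \<Rightarrow> nat) \<Rightarrow> nat \<Rightarrow> (nat \<Rightarrow> nat \<Rightarrow> nat) set" where
  "slot_tuples n d l \<equiv> {1..l} \<rightarrow>\<^sub>E multi_indices n d"

text \<open>
  This is a right action: position \<open>j\<close> of the new tuple takes its \<open>i\<close>-th component from position
  \<open>\<sigma> i j\<close> of the old one. The restrictions keep the result in the set of tuples when \<open>\<sigma>\<close> is arbitrary
  outside \<open>{1..n}\<close>.
\<close>

definition slot_act :: "nat \<Rightarrow> nat \<Rightarrow> (nat \<Rightarrow> nat \<Rightarrow> nat) \<Rightarrow> (nat \<Rightarrow> nat \<Rightarrow> nat) \<Rightarrow> nat \<Rightarrow> nat \<Rightarrow> nat" where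
  "slot_act n l \<sigma> a = (\<lambda>j\<in>{1..l}. \<lambda>i\<in>{1..n}. a (\<sigma> i j) i)"

lemma slot_act_mem:
  assumes \<sigma>: "\<And>i. i \<in> {1..n} \<Longrightarrow> \<sigma> i permutes {1..l}" and a: "a \<in> slot_tuples n d l"
  shows "slot_act n l \<sigma> a \<in> slot_tuples n d l"
proof -
  have "a (\<sigma> i j) i < d i" if "i \<in> {1..n}" "j \<in> {1..l}" for i j
    using PiE_mem[OF a, of "\<sigma> i j"] permutes_in_image[OF \<sigma>[OF that(1)], of j] that
    unfolding multi_indices_def by (auto simp: PiE_iff)
  then show ?thesis unfolding slot_act_def multi_indices_def by auto
qed

lemma slot_tuple_eqI:
  assumes "a \<in> slot_tuples n d l" "b \<in> slot_tuples n d l"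
    and "\<And>i j. i \<in> {1..n} \<Longrightarrow> j \<in> {1..l} \<Longrightarrow> a j i = b j i"
  shows "a = b"
proof (rule PiE_ext[OF assms(1,2)])
  fix j assume j: "j \<in> {1..l}"
  show "a j = b j"
    using PiE_mem[OF assms(1) j] PiE_mem[OF assms(2) j] assms(3)[OF _ j]
    unfolding multi_indices_def by (rule PiE_ext)
qed

lemma slot_act_comp:
  assumes "\<And>i. i \<in> {1..n} \<Longrightarrow> \<tau> i permutes {1..l}"
  shows "slot_act n l \<tau> (slot_act n l \<sigma> a) = slot_act n l (\<lambda>i. \<sigma> i \<circ> \<tau> i) a"
  using permutes_in_image[OF assms]
  by (auto simp: slot_act_def fun_eq_iff restrict_def)

lemma slot_act_id:
  assumes "a \<in> slot_tuples n d l"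
  shows "slot_act n l (\<lambda>i. id) a = a"
  using assms slot_act_mem[OF _ assms, of "\<lambda>i. id"]
  by (intro slot_tuple_eqI[of _ l n d]) (auto simp: slot_act_def permutes_id)

lemma slot_act_inverse:
  assumes \<sigma>: "\<And>i. i \<in> {1..n} \<Longrightarrow> \<sigma> i permutes {1..l}"
    and a: "a \<in> slot_tuples n d l"
  shows "slot_act n l (\<lambda>i. Hilbert_Choice.inv (\<sigma> i)) (slot_act n l \<sigma> a) = a"
    and "slot_act n l \<sigma> (slot_act n l (\<lambda>i. Hilbert_Choice.inv (\<sigma> i)) a) = a"
proof -
  let ?inv = "\<lambda>i. Hilbert_Choice.inv (\<sigma> i)"
  have inv: "\<And>i. i \<in> {1..n} \<Longrightarrow> ?inv i permutes {1..l}" using \<sigma> by (intro permutes_inv)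
  have cong: "slot_act n l \<rho> a = slot_act n l \<rho>' a" if "\<And>i. i \<in> {1..n} \<Longrightarrow> \<rho> i = \<rho>' i" for \<rho> \<rho>'
    using that by (auto simp: slot_act_def fun_eq_iff restrict_def)
  have "slot_act n l ?inv (slot_act n l \<sigma> a) = slot_act n l (\<lambda>i. \<sigma> i \<circ> ?inv i) a"
    by (rule slot_act_comp[OF inv])
  also have "\<dots> = slot_act n l (\<lambda>i. id) a" by (rule cong) (rule permutes_inv_o[OF \<sigma>])
  finally show "slot_act n l ?inv (slot_act n l \<sigma> a) = a" unfolding slot_act_id[OF a] .
  have "slot_act n l \<sigma> (slot_act n l ?inv a) = slot_act n l (\<lambda>i. ?inv i \<circ> \<sigma> i) a"
    by (rule slot_act_comp[OF \<sigma>])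
  also have "\<dots> = slot_act n l (\<lambda>i. id) a" by (rule cong) (rule permutes_inv_o[OF \<sigma>])
  finally show "slot_act n l \<sigma> (slot_act n l ?inv a) = a" unfolding slot_act_id[OF a] .
qed

lemma slot_act_bij:
  assumes \<sigma>: "\<And>i. i \<in> {1..n} \<Longrightarrow> \<sigma> i permutes {1..l}"
  shows "bij_betw (slot_act n l \<sigma>) (slot_tuples n d l) (slot_tuples n d l)"
proof (rule bij_betw_byWitness[where f' = "slot_act n l (\<lambda>i. Hilbert_Choice.inv (\<sigma> i))"])
  show "slot_act n l \<sigma> ` (slot_tuples n d l) \<subseteq> slot_tuples n d l"
    by (intro image_subsetI slot_act_mem \<sigma>)
  show "slot_act n l (\<lambda>i. Hilbert_Choice.inv (\<sigma> i)) ` (slot_tuples n d l) \<subseteq>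
      slot_tuples n d l"
    using \<sigma> by (intro image_subsetI slot_act_mem permutes_inv)
qed (intro ballI slot_act_inverse \<sigma>; assumption)+

text \<open>
  The indices of the matrix units match along all cycles of all \<open>\<sigma> i\<close> exactly when the column tuple
  is \<open>slot_act n l \<sigma>\<close> of the row tuple, so the matrix of the trace function is a permutation matrix.
\<close>

lemma tensor_trace_eq:
  fixes A :: "nat \<Rightarrow> 'k::field tensor_mat"
  assumes \<sigma>: "\<And>i. i \<in> {1..n} \<Longrightarrow> \<sigma> i permutes {1..l}"
  shows "tensor_trace n d l \<sigma> A =
    (\<Sum>a\<in>slot_tuples n d l. \<Prod>j=1..l. A j (a j, slot_act n l \<sigma> a j))"
proof -
  let ?X = "slot_tuples n d l"
  have fin: "finite ?X" by (intro finite_PiE finite_multi_indices) auto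
  have mem: "slot_act n l \<sigma> a \<in> ?X" if "a \<in> ?X" for a
    by (rule slot_act_mem[OF _ that]) (rule \<sigma>)
  have "tensor_trace n d l \<sigma> A = (\<Sum>a\<in>?X. \<Sum>b\<in>?X. (\<Prod>j=1..l. A j (a j, b j)) *
     (\<Prod>i=1..n. cycle_trace (d i) l (\<sigma> i) (\<lambda>j. matrix_unit (d i) (a j i, b j i))))"
    unfolding tensor_trace_def sum_PiE_Times
    by (intro sum.cong refl arg_cong2[where f = times] prod.cong cycle_trace_cong \<sigma>) auto
  also have "\<dots> = (\<Sum>a\<in>?X. \<Sum>b\<in>?X. if b = slot_act n l \<sigma> a then \<Prod>j=1..l. A j (a j, b j) else 0)"
  proof (intro sum.cong refl)
    fix a b assume a: "a \<in> ?X" and b: "b \<in> ?X"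
    have lt: "a j i < d i \<and> b j i < d i" if "i \<in> {1..n}" "j \<in> {1..l}" for i j
      using PiE_mem[OF a that(2)] PiE_mem[OF b that(2)] that(1)
      unfolding multi_indices_def by (auto simp: PiE_iff)
    have "(\<Prod>i=1..n. cycle_trace (d i) l (\<sigma> i) (\<lambda>j. matrix_unit (d i) (a j i, b j i))) =
        (\<Prod>i=1..n. of_bool (\<forall>j\<in>{1..l}. b j i = a (\<sigma> i j) i) :: 'k)"
      using lt by (intro prod.cong refl cycle_trace_matrix_units \<sigma>) auto
    also have "\<dots> = of_bool (\<forall>i\<in>{1..n}. \<forall>j\<in>{1..l}. b j i = a (\<sigma> i j) i)"
      by (rule prod_of_bool) simp
    also have "(\<forall>i\<in>{1..n}. \<forall>j\<in>{1..l}. b j i = a (\<sigma> i j) i) \<longleftrightarrow> b = slot_act n l \<sigma> a"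
    proof
      assume "\<forall>i\<in>{1..n}. \<forall>j\<in>{1..l}. b j i = a (\<sigma> i j) i"
      then show "b = slot_act n l \<sigma> a"
        by (intro slot_tuple_eqI[OF b mem[OF a]]) (simp add: slot_act_def)
    qed (simp add: slot_act_def)
    finally show "(\<Prod>j=1..l. A j (a j, b j)) *
       (\<Prod>i=1..n. cycle_trace (d i) l (\<sigma> i) (\<lambda>j. matrix_unit (d i) (a j i, b j i))) =
       (if b = slot_act n l \<sigma> a then \<Prod>j=1..l. A j (a j, b j) else 0)" by simp
  qed
  also have "\<dots> = (\<Sum>a\<in>?X. \<Prod>j=1..l. A j (a j, slot_act n l \<sigma> a j))"
    by (intro sum.cong[OF refl]) (simp add: fin mem del: One_nat_def)
  finally show ?thesis .
qed

lemma tensor_trace_cong: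
  assumes "\<And>j. j \<in> {1..l} \<Longrightarrow> A j = B j"
  shows "tensor_trace n d l \<sigma> A = tensor_trace n d l \<sigma> B"
  unfolding tensor_trace_def
  by (intro sum.cong[OF refl] arg_cong2[where f = times] prod.cong[OF refl] refl) (simp add: assms)

section \<open>Conjugation by simple tensors\<close>

lemma tensor_mat_mult_closed: "tensor_mat_mult n d A B \<in> End_tensor n d"
  unfolding tensor_mat_mult_def End_tensor_def by auto

lemma tensor_mat_mult_assoc:
  "tensor_mat_mult n d (tensor_mat_mult n d A B) C = tensor_mat_mult n d A (tensor_mat_mult n d B C)"
proof -
  let ?I = "multi_indices n d"
  have "(\<Sum>c\<in>?I. (\<Sum>e\<in>?I. A (a, e) * B (e, c)) * C (c, b)) =
      (\<Sum>e\<in>?I. A (a, e) * (\<Sum>c\<in>?I. B (e, c) * C (c, b)))" for a b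
    unfolding sum_distrib_left sum_distrib_right by (subst sum.swap) (simp add: mult.assoc)
  then show ?thesis
    unfolding tensor_mat_mult_def by (intro ext) (auto simp: restrict_def)
qed

lemma simple_tensor_mult:
  fixes X Y :: "nat \<Rightarrow> 'k::field mat"
  assumes X: "\<And>i. i \<in> {1..n} \<Longrightarrow> X i \<in> carrier_mat (d i) (d i)"
    and Y: "\<And>i. i \<in> {1..n} \<Longrightarrow> Y i \<in> carrier_mat (d i) (d i)"
  shows "tensor_mat_mult n d (simple_tensor n d X) (simple_tensor n d Y) =
    simple_tensor n d (\<lambda>i. X i * Y i)"
proof -
  have "(\<Sum>c\<in>multi_indices n d. (\<Prod>i=1..n. X i $$ (a i, c i)) * (\<Prod>i=1..n. Y i $$ (c i, b i))) =
      (\<Prod>i=1..n. (X i * Y i) $$ (a i, b i))"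
    if a: "a \<in> multi_indices n d" and b: "b \<in> multi_indices n d" for a b
  proof -
    have "(\<Prod>i=1..n. (X i * Y i) $$ (a i, b i)) = (\<Prod>i=1..n. \<Sum>c<d i. X i $$ (a i, c) * Y i $$ (c, b i))"
    proof (rule prod.cong[OF refl])
      fix i assume i: "i \<in> {1..n}"
      have "a i < d i" "b i < d i"
        using PiE_mem[OF a[unfolded multi_indices_def] i] PiE_mem[OF b[unfolded multi_indices_def] i] by auto
      then show "(X i * Y i) $$ (a i, b i) = (\<Sum>c<d i. X i $$ (a i, c) * Y i $$ (c, b i))"
        using X[OF i] Y[OF i] by (auto simp: scalar_prod_def lessThan_atLeast0)
    qed
    also have "\<dots> = (\<Sum>c\<in>multi_indices n d. \<Prod>i=1..n. X i $$ (a i, c i) * Y i $$ (c i, b i))"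
      unfolding multi_indices_def by (rule prod_sum_PiE) auto
    finally show ?thesis by (simp add: prod.distrib)
  qed
  then show ?thesis
    unfolding tensor_mat_mult_def simple_tensor_def by (intro ext) (auto simp: restrict_def)
qed

lemma simple_tensor_one:
  fixes A :: "'k::field tensor_mat"
  assumes A: "A \<in> End_tensor n d"
  shows "tensor_mat_mult n d (simple_tensor n d (\<lambda>i. 1\<^sub>m (d i))) A = A"
    and "tensor_mat_mult n d A (simple_tensor n d (\<lambda>i. 1\<^sub>m (d i))) = A"
proof -
  let ?I = "multi_indices n d"
  have one: "simple_tensor n d (\<lambda>i. 1\<^sub>m (d i)) (a, b) = (if a = b then 1 else 0 :: 'k)"
    if a: "a \<in> ?I" and b: "b \<in> ?I" for a b
  proof -
    have lt: "a i < d i" "b i < d i" if "i \<in> {1..n}" for i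
      using PiE_mem[OF a[unfolded multi_indices_def] that] PiE_mem[OF b[unfolded multi_indices_def] that]
      by auto
    have "a = b \<longleftrightarrow> (\<forall>i\<in>{1..n}. a i = b i)"
      using PiE_ext[OF a[unfolded multi_indices_def] b[unfolded multi_indices_def]] by auto
    moreover have "simple_tensor n d (\<lambda>i. 1\<^sub>m (d i)) (a, b) = (\<Prod>i=1..n. if a i = b i then 1 else 0 :: 'k)"
      unfolding simple_tensor_def using a b lt by (auto intro!: prod.cong)
    moreover have "(\<Prod>i=1..n. if a i = b i then 1 else 0) = (if \<forall>i\<in>{1..n}. a i = b i then 1 else 0 :: 'k)"
      by (auto simp: prod_zero_iff)
    ultimately show ?thesis by simp
  qed
  have ext: "A \<in> extensional (?I \<times> ?I)" using A by (simp add: End_tensor_def PiE_iff)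
  have "tensor_mat_mult n d (simple_tensor n d (\<lambda>i. 1\<^sub>m (d i))) A (a, b) = A (a, b)"
    "tensor_mat_mult n d A (simple_tensor n d (\<lambda>i. 1\<^sub>m (d i))) (a, b) = A (a, b)" for a b
    using extensional_arb[OF ext, of "(a, b)"] finite_multi_indices[of n d]
    by (auto simp: tensor_mat_mult_def one if_distrib[of "\<lambda>x. x * _"] if_distrib[of "(*) _"]
        cong: if_cong sum.cong_simp)
  then show "tensor_mat_mult n d (simple_tensor n d (\<lambda>i. 1\<^sub>m (d i))) A = A"
    "tensor_mat_mult n d A (simple_tensor n d (\<lambda>i. 1\<^sub>m (d i))) = A"
    by auto
qed

lemma GL_prod_inverse:
  fixes g :: "nat \<Rightarrow> 'k::field mat"
  assumes g: "g \<in> GL_prod n d"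
  defines "g' \<equiv> \<lambda>i. inv\<^bsub>ring_mat TYPE('k) (d i) ()\<^esub> (g i)"
  shows "tensor_mat_mult n d (simple_tensor n d g) (simple_tensor n d g') = simple_tensor n d (\<lambda>i. 1\<^sub>m (d i))"
    and "tensor_mat_mult n d (simple_tensor n d g') (simple_tensor n d g) = simple_tensor n d (\<lambda>i. 1\<^sub>m (d i))"
proof -
  have *: "g i \<in> carrier_mat (d i) (d i) \<and> g' i \<in> carrier_mat (d i) (d i) \<and>
      g i * g' i = 1\<^sub>m (d i) \<and> g' i * g i = 1\<^sub>m (d i)" if "i \<in> {1..n}" for i
  proof -
    interpret R: ring "ring_mat TYPE('k) (d i) ()" by (rule ring_mat)
    have "g i \<in> Units (ring_mat TYPE('k) (d i) ())" using g that unfolding GL_prod_def by auto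
    from R.Units_closed[OF this] R.Units_inv_closed[OF this] R.Units_r_inv[OF this] R.Units_l_inv[OF this]
    show ?thesis unfolding g'_def by (simp add: ring_mat_simps)
  qed
  have cong: "simple_tensor n d Y = simple_tensor n d Z" if "\<And>i. i \<in> {1..n} \<Longrightarrow> Y i = Z i"
    for Y Z :: "nat \<Rightarrow> 'k mat"
    using that unfolding simple_tensor_def by (auto intro!: ext prod.cong simp: restrict_def)
  show "tensor_mat_mult n d (simple_tensor n d g) (simple_tensor n d g') = simple_tensor n d (\<lambda>i. 1\<^sub>m (d i))"
    using * by (subst simple_tensor_mult) (auto intro: cong)
  show "tensor_mat_mult n d (simple_tensor n d g') (simple_tensor n d g) = simple_tensor n d (\<lambda>i. 1\<^sub>m (d i))"
    using * by (subst simple_tensor_mult) (auto intro: cong)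
qed

lemma simultaneous_conj_closed: "simultaneous_conj n d m g M \<in> End_power n d m"
  unfolding simultaneous_conj_def tensor_conj_def End_power_def by (auto intro: tensor_mat_mult_closed)

text \<open>
  Substituting \<open>M g\<close> for \<open>M\<close> removes the inverse of \<open>g\<close>, so that only polynomials in the entries of
  \<open>g\<close> are left.
\<close>

lemma conj_invariant_iff:
  fixes f :: "(nat \<Rightarrow> 'k::field tensor_mat) \<Rightarrow> 'a"
  assumes g: "g \<in> GL_prod n d"
  shows "(\<forall>M\<in>End_power n d m. f (simultaneous_conj n d m g M) = f M) \<longleftrightarrow>
    (\<forall>M\<in>End_power n d m.
      f (\<lambda>p\<in>{1..m}. tensor_mat_mult n d (simple_tensor n d g) (M p)) =
      f (\<lambda>p\<in>{1..m}. tensor_mat_mult n d (M p) (simple_tensor n d g)))" (is "?L \<longleftrightarrow> ?R")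
proof
  let ?g = "simple_tensor n d g"
    and ?g' = "simple_tensor n d (\<lambda>i. inv\<^bsub>ring_mat TYPE('k) (d i) ()\<^esub> (g i))"
  note inv = GL_prod_inverse[OF g]
  have M: "M p \<in> End_tensor n d" if "M \<in> End_power n d m" "p \<in> {1..m}" for M :: "nat \<Rightarrow> 'k tensor_mat" and p
    using that unfolding End_power_def by auto
  {
    assume L: ?L
    show ?R
    proof
      fix M :: "nat \<Rightarrow> 'k tensor_mat" assume "M \<in> End_power n d m"
      note M = M[OF this]
      let ?N = "\<lambda>p\<in>{1..m}. tensor_mat_mult n d (M p) ?g"
      have "simultaneous_conj n d m g ?N = (\<lambda>p\<in>{1..m}. tensor_mat_mult n d ?g (M p))"
        unfolding simultaneous_conj_def tensor_conj_def
        using M by (intro restrict_ext) (simp add: tensor_mat_mult_assoc inv simple_tensor_one)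
      moreover have "?N \<in> End_power n d m"
        unfolding End_power_def by (auto intro: tensor_mat_mult_closed)
      ultimately show "f (\<lambda>p\<in>{1..m}. tensor_mat_mult n d ?g (M p)) = f ?N" using L by metis
    qed
  next
    assume R: ?R
    show ?L
    proof
      fix M :: "nat \<Rightarrow> 'k tensor_mat" assume M0: "M \<in> End_power n d m"
      note M = M[OF this]
      let ?N = "\<lambda>p\<in>{1..m}. tensor_mat_mult n d (M p) ?g'"
      have left: "(\<lambda>p\<in>{1..m}. tensor_mat_mult n d ?g (?N p)) = simultaneous_conj n d m g M"
        unfolding simultaneous_conj_def tensor_conj_def
        by (intro restrict_ext) (simp add: tensor_mat_mult_assoc)
      have "(\<lambda>p\<in>{1..m}. tensor_mat_mult n d (?N p) ?g) = restrict M {1..m}"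
        using M by (intro restrict_ext) (simp add: tensor_mat_mult_assoc inv simple_tensor_one)
      also have "\<dots> = M"
        using M0 unfolding End_power_def by (intro extensional_restrict) (simp add: PiE_iff)
      finally have right: "(\<lambda>p\<in>{1..m}. tensor_mat_mult n d (?N p) ?g) = M" .
      have "?N \<in> End_power n d m"
        unfolding End_power_def by (auto intro: tensor_mat_mult_closed)
      from bspec[OF R this] show "f (simultaneous_conj n d m g M) = f M" unfolding left right .
    qed
  }
qed

section \<open>Multilinear forms and tensor powers\<close>

definition slot_form :: "nat \<Rightarrow> (nat \<Rightarrow> nat) \<Rightarrow> nat \<Rightarrow>
    ((nat \<Rightarrow> nat \<Rightarrow> nat) \<Rightarrow> (nat \<Rightarrow> nat \<Rightarrow> nat) \<Rightarrow> 'k) \<Rightarrow> (nat \<Rightarrow> 'k::field tensor_mat) \<Rightarrow> 'k" where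
  "slot_form n d l F A = (\<Sum>a\<in>slot_tuples n d l. \<Sum>b\<in>slot_tuples n d l.
     F a b * (\<Prod>j=1..l. A j (a j, b j)))"

text \<open>
  The transpose of the \<open>l\<close>-th tensor power of \<open>G\<close>. With the transpose, multiplying the arguments of a
  form by \<open>G\<close> on the left (right) multiplies its matrix on the left (right).
\<close>

definition slot_kernel :: "nat \<Rightarrow> 'k::field tensor_mat \<Rightarrow>
    (nat \<Rightarrow> nat \<Rightarrow> nat) \<Rightarrow> (nat \<Rightarrow> nat \<Rightarrow> nat) \<Rightarrow> 'k" where
  "slot_kernel l G x y = (\<Prod>j=1..l. G (y j, x j))"

lemma slot_form_cong:
  assumes "\<And>a b. a \<in> slot_tuples n d l \<Longrightarrow> b \<in> slot_tuples n d l \<Longrightarrow> F a b = F' a b"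
    and "\<And>j. j \<in> {1..l} \<Longrightarrow> A j = A' j"
  shows "slot_form n d l F A = slot_form n d l F' A'"
  unfolding slot_form_def using assms by (intro sum.cong[OF refl] arg_cong2[where f = times] prod.cong[OF refl]) auto

lemma slot_form_diff:
  "slot_form n d l (\<lambda>x y. F x y - F' x y) A = slot_form n d l F A - slot_form n d l F' A"
  unfolding slot_form_def by (simp add: left_diff_distrib sum_subtractf)

lemma sum_rotate:
  "(\<Sum>a\<in>A. \<Sum>b\<in>B. \<Sum>c\<in>C. f a b c) = (\<Sum>c\<in>C. \<Sum>b\<in>B. \<Sum>a\<in>A. f a b c :: 'a::comm_monoid_add)"
proof -
  have "(\<Sum>a\<in>A. \<Sum>b\<in>B. \<Sum>c\<in>C. f a b c) = (\<Sum>a\<in>A. \<Sum>c\<in>C. \<Sum>b\<in>B. f a b c)"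
    by (intro sum.cong[OF refl] sum.swap)
  also have "\<dots> = (\<Sum>c\<in>C. \<Sum>a\<in>A. \<Sum>b\<in>B. f a b c)" by (rule sum.swap)
  also have "\<dots> = (\<Sum>c\<in>C. \<Sum>b\<in>B. \<Sum>a\<in>A. f a b c)" by (intro sum.cong[OF refl] sum.swap)
  finally show ?thesis .
qed

lemma slot_form_mult_left:
  "slot_form n d l F (\<lambda>j. tensor_mat_mult n d G (A j)) =
    slot_form n d l (\<lambda>x y. \<Sum>z\<in>slot_tuples n d l. slot_kernel l G x z * F z y) A"
proof -
  let ?I = "multi_indices n d" let ?X = "{1..l} \<rightarrow>\<^sub>E ?I"
  have prod: "(\<Prod>j=1..l. tensor_mat_mult n d G (A j) (a j, b j)) =
      (\<Sum>c\<in>?X. slot_kernel l G c a * (\<Prod>j=1..l. A j (c j, b j)))" if "a \<in> ?X" "b \<in> ?X" for a b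
  proof -
    have "(\<Prod>j=1..l. tensor_mat_mult n d G (A j) (a j, b j)) =
        (\<Prod>j=1..l. \<Sum>e\<in>?I. G (a j, e) * A j (e, b j))"
      using PiE_mem[OF that(1)] PiE_mem[OF that(2)] by (intro prod.cong) (auto simp: tensor_mat_mult_def)
    also have "\<dots> = (\<Sum>c\<in>?X. \<Prod>j=1..l. G (a j, c j) * A j (c j, b j))"
      by (rule prod_sum_PiE) (auto simp: finite_multi_indices)
    finally show ?thesis by (simp add: prod.distrib slot_kernel_def)
  qed
  have "slot_form n d l F (\<lambda>j. tensor_mat_mult n d G (A j)) =
      (\<Sum>a\<in>?X. \<Sum>b\<in>?X. \<Sum>c\<in>?X. slot_kernel l G c a * F a b * (\<Prod>j=1..l. A j (c j, b j)))"
    unfolding slot_form_def by (intro sum.cong[OF refl]) (simp add: prod sum_distrib_left mult_ac del: One_nat_def)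
  also have "\<dots> = (\<Sum>c\<in>?X. \<Sum>b\<in>?X. \<Sum>a\<in>?X. slot_kernel l G c a * F a b * (\<Prod>j=1..l. A j (c j, b j)))"
    by (rule sum_rotate)
  finally show ?thesis unfolding slot_form_def by (simp add: sum_distrib_right)
qed

lemma slot_form_mult_right:
  "slot_form n d l F (\<lambda>j. tensor_mat_mult n d (A j) G) =
    slot_form n d l (\<lambda>x y. \<Sum>z\<in>slot_tuples n d l. F x z * slot_kernel l G z y) A"
proof -
  let ?I = "multi_indices n d" let ?X = "{1..l} \<rightarrow>\<^sub>E ?I"
  have prod: "(\<Prod>j=1..l. tensor_mat_mult n d (A j) G (a j, b j)) =
      (\<Sum>c\<in>?X. slot_kernel l G b c * (\<Prod>j=1..l. A j (a j, c j)))" if "a \<in> ?X" "b \<in> ?X" for a b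
  proof -
    have "(\<Prod>j=1..l. tensor_mat_mult n d (A j) G (a j, b j)) =
        (\<Prod>j=1..l. \<Sum>e\<in>?I. G (e, b j) * A j (a j, e))"
      using PiE_mem[OF that(1)] PiE_mem[OF that(2)]
      by (intro prod.cong) (auto simp: tensor_mat_mult_def mult.commute)
    also have "\<dots> = (\<Sum>c\<in>?X. \<Prod>j=1..l. G (c j, b j) * A j (a j, c j))"
      by (rule prod_sum_PiE) (auto simp: finite_multi_indices)
    finally show ?thesis by (simp add: prod.distrib slot_kernel_def)
  qed
  have "slot_form n d l F (\<lambda>j. tensor_mat_mult n d (A j) G) =
      (\<Sum>a\<in>?X. \<Sum>b\<in>?X. \<Sum>c\<in>?X. F a b * slot_kernel l G b c * (\<Prod>j=1..l. A j (a j, c j)))"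
    unfolding slot_form_def by (intro sum.cong[OF refl]) (simp add: prod sum_distrib_left mult_ac del: One_nat_def)
  also have "\<dots> = (\<Sum>a\<in>?X. \<Sum>c\<in>?X. \<Sum>b\<in>?X. F a b * slot_kernel l G b c * (\<Prod>j=1..l. A j (a j, c j)))"
    by (intro sum.cong[OF refl] sum.swap)
  finally show ?thesis unfolding slot_form_def by (simp add: sum_distrib_right)
qed

lemma slot_kernel_simple_tensor:
  assumes x: "x \<in> slot_tuples n d l" and y: "y \<in> slot_tuples n d l"
  shows "slot_kernel l (simple_tensor n d g) x y = (\<Prod>i=1..n. \<Prod>j=1..l. g i $$ (y j i, x j i))"
proof -
  have "slot_kernel l (simple_tensor n d g) x y = (\<Prod>j=1..l. \<Prod>i=1..n. g i $$ (y j i, x j i))"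
    unfolding slot_kernel_def
  proof (rule prod.cong[OF refl])
    fix j assume "j \<in> {1..l}"
    then have "x j \<in> multi_indices n d" "y j \<in> multi_indices n d" using x y by (auto dest: PiE_mem)
    then show "simple_tensor n d g (y j, x j) = (\<Prod>i=1..n. g i $$ (y j i, x j i))"
      by (simp add: simple_tensor_def)
  qed
  then show ?thesis by (simp only: prod.swap[of _ "{1..l}"])
qed

text \<open>
  In the entry of the tensor power of \<open>g\<^sub>1 \<otimes> \<dots> \<otimes> g\<^sub>n\<close> the factors that belong to \<open>g\<^sub>i\<close> can be
  permuted among themselves.
\<close>

lemma slot_kernel_invariant:
  assumes \<sigma>: "\<And>i. i \<in> {1..n} \<Longrightarrow> \<sigma> i permutes {1..l}"
    and x: "x \<in> slot_tuples n d l" and y: "y \<in> slot_tuples n d l"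
  shows "slot_kernel l (simple_tensor n d g) (slot_act n l \<sigma> x) (slot_act n l \<sigma> y) =
    slot_kernel l (simple_tensor n d g) x y"
proof -
  have mem: "slot_act n l \<sigma> z \<in> slot_tuples n d l" if "z \<in> slot_tuples n d l" for z
    by (rule slot_act_mem[OF _ that]) (rule \<sigma>)
  show ?thesis
    unfolding slot_kernel_simple_tensor[OF mem[OF x] mem[OF y]] slot_kernel_simple_tensor[OF x y]
  proof (rule prod.cong[OF refl])
    fix i assume i: "i \<in> {1..n}"
    show "(\<Prod>j=1..l. g i $$ (slot_act n l \<sigma> y j i, slot_act n l \<sigma> x j i)) =
        (\<Prod>j=1..l. g i $$ (y j i, x j i))"
      unfolding prod.permute[OF \<sigma>[OF i], of "\<lambda>j. g i $$ (y j i, x j i)"]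
      using i by (intro prod.cong[OF refl]) (simp add: slot_act_def)
  qed
qed

lemma slot_form_slot_act:
  assumes \<sigma>: "\<And>i. i \<in> {1..n} \<Longrightarrow> \<sigma> i permutes {1..l}"
  shows "slot_form n d l (\<lambda>x y. of_bool (y = slot_act n l \<sigma> x)) A = tensor_trace n d l \<sigma> A"
proof -
  let ?X = "slot_tuples n d l"
  have fin: "finite ?X" by (intro finite_PiE finite_multi_indices) auto
  have mem: "slot_act n l \<sigma> a \<in> ?X" if "a \<in> ?X" for a
    by (rule slot_act_mem[OF _ that]) (rule \<sigma>)
  have "tensor_trace n d l \<sigma> A = (\<Sum>a\<in>?X. \<Prod>j=1..l. A j (a j, slot_act n l \<sigma> a j))"
    by (rule tensor_trace_eq) (rule \<sigma>)
  also have "\<dots> = slot_form n d l (\<lambda>x y. of_bool (y = slot_act n l \<sigma> x)) A"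
    unfolding slot_form_def
    by (intro sum.cong[OF refl])
      (simp add: fin mem of_bool_def if_distrib[of "\<lambda>x. x * _"] del: One_nat_def cong: if_cong)
  finally show ?thesis by simp
qed

lemma slot_form_perm_sum:
  assumes fin: "finite \<Sigma>" and \<sigma>: "\<And>\<sigma> i. \<sigma> \<in> \<Sigma> \<Longrightarrow> i \<in> {1..n} \<Longrightarrow> \<sigma> i permutes {1..l}"
    and F: "\<And>x y. x \<in> slot_tuples n d l \<Longrightarrow> y \<in> slot_tuples n d l \<Longrightarrow>
      F x y = (\<Sum>\<sigma>\<in>\<Sigma>. c \<sigma> * of_bool (y = slot_act n l \<sigma> x))"
  shows "slot_form n d l F A = (\<Sum>\<sigma>\<in>\<Sigma>. c \<sigma> * tensor_trace n d l \<sigma> A)"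
proof -
  let ?X = "slot_tuples n d l"
  have "slot_form n d l F A = (\<Sum>x\<in>?X. \<Sum>y\<in>?X. \<Sum>\<sigma>\<in>\<Sigma>.
      c \<sigma> * (of_bool (y = slot_act n l \<sigma> x) * (\<Prod>j=1..l. A j (x j, y j))))"
    unfolding slot_form_def
    by (intro sum.cong[OF refl]) (simp add: F sum_distrib_right mult.assoc del: One_nat_def)
  also have "\<dots> = (\<Sum>\<sigma>\<in>\<Sigma>. \<Sum>y\<in>?X. \<Sum>x\<in>?X.
      c \<sigma> * (of_bool (y = slot_act n l \<sigma> x) * (\<Prod>j=1..l. A j (x j, y j))))"
    by (rule sum_rotate)
  also have "\<dots> = (\<Sum>\<sigma>\<in>\<Sigma>. c \<sigma> * slot_form n d l (\<lambda>x y. of_bool (y = slot_act n l \<sigma> x)) A)"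
    unfolding slot_form_def sum_distrib_left by (intro sum.cong[OF refl] sum.swap)
  also have "\<dots> = (\<Sum>\<sigma>\<in>\<Sigma>. c \<sigma> * tensor_trace n d l \<sigma> A)"
    by (intro sum.cong[OF refl] arg_cong2[where f = times] refl slot_form_slot_act \<sigma>)
  finally show ?thesis .
qed

text \<open>
  The permutation matrix of \<open>\<sigma>\<close> commutes with the \<open>slot_kernel\<close> of a simple tensor, since the latter is
  invariant under \<open>\<sigma>\<close> acting on rows and columns.
\<close>

lemma tensor_trace_mult_commute:
  fixes A :: "nat \<Rightarrow> 'k::field tensor_mat"
  assumes \<sigma>: "\<And>i. i \<in> {1..n} \<Longrightarrow> \<sigma> i permutes {1..l}"
  shows "tensor_trace n d l \<sigma> (\<lambda>j. tensor_mat_mult n d (simple_tensor n d g) (A j)) =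
    tensor_trace n d l \<sigma> (\<lambda>j. tensor_mat_mult n d (A j) (simple_tensor n d g))"
proof -
  let ?X = "slot_tuples n d l" and ?K = "slot_kernel l (simple_tensor n d g)"
    and ?s = "slot_act n l \<sigma>"
  have fin: "finite ?X" by (intro finite_PiE finite_multi_indices) auto
  have mem: "?s a \<in> ?X" if "a \<in> ?X" for a
    by (rule slot_act_mem[OF _ that]) (rule \<sigma>)
  have bij: "bij_betw ?s ?X ?X" by (rule slot_act_bij) (rule \<sigma>)
  have eq: "(\<Sum>z\<in>?X. ?K x z * of_bool (y = ?s z)) = (\<Sum>z\<in>?X. of_bool (z = ?s x) * ?K z y)"
    if x: "x \<in> ?X" and y: "y \<in> ?X" for x y
  proof -
    have "y \<in> ?s ` ?X" unfolding bij_betw_imp_surj_on[OF bij] by (rule y)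
    then obtain z0 where z0: "z0 \<in> ?X" "y = ?s z0" by blast
    have "(\<Sum>z\<in>?X. ?K x z * of_bool (y = ?s z)) = (\<Sum>z\<in>?X. if z = z0 then ?K x z else 0)"
      using bij_betw_imp_inj_on[OF bij] z0 by (intro sum.cong[OF refl]) (auto simp: inj_on_eq_iff)
    also have "\<dots> = ?K x z0" using fin z0 by simp
    also have "\<dots> = ?K (?s x) y" unfolding z0(2) by (rule slot_kernel_invariant[OF _ x z0(1), symmetric]) (rule \<sigma>)
    also have "\<dots> = (\<Sum>z\<in>?X. if z = ?s x then ?K z y else 0)" using fin mem[OF x] by simp
    also have "\<dots> = (\<Sum>z\<in>?X. of_bool (z = ?s x) * ?K z y)" by (intro sum.cong[OF refl]) auto
    finally show ?thesis .
  qed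
  have tr: "tensor_trace n d l \<sigma> B = slot_form n d l (\<lambda>x y. of_bool (y = ?s x)) B" for B :: "nat \<Rightarrow> 'k tensor_mat"
    by (rule slot_form_slot_act[symmetric]) (rule \<sigma>)
  show ?thesis unfolding tr slot_form_mult_left slot_form_mult_right
    by (rule slot_form_cong[OF _ refl]) (rule eq)
qed

section \<open>The commutant of the tensor powers\<close>

text \<open>
  Density of the invertible matrices, by a one-parameter argument: for a given tuple \<open>h\<close> of matrices the
  value at \<open>h + s\<close> is a polynomial in \<open>s\<close>, and its product with the determinants of the
  \<open>h i + s\<close> vanishes for all \<open>s\<close>. These determinants are values of characteristic polynomials, hence
  not zero as polynomials. A variable is a triple \<open>(i, r, s)\<close>, standing for the entry \<open>(r, s)\<close>
  of the \<open>i\<close>-th matrix.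
\<close>

lemma polynomial_vanishing_on_GL_prod:
  fixes c :: "'w \<Rightarrow> 'k::field_char_0" and u :: "'w \<Rightarrow> 'j \<Rightarrow> nat \<times> nat \<times> nat"
  assumes u: "\<And>w j. w \<in> W \<Longrightarrow> j \<in> J w \<Longrightarrow> u w j \<in> (SIGMA i:{1..n}. {..<d i} \<times> {..<d i})"
    and zero: "\<And>g. g \<in> GL_prod n d \<Longrightarrow>
      (\<Sum>w\<in>W. c w * (\<Prod>j\<in>J w. g (fst (u w j)) $$ snd (u w j))) = 0"
  shows "(\<Sum>w\<in>W. c w * (\<Prod>j\<in>J w. x (u w j))) = 0"
proof -
  define h where "h i = mat (d i) (d i) (\<lambda>t. x (i, t))" for i
  define h' where "h' s i = mat (d i) (d i) (\<lambda>t. x (i, t) + (if fst t = snd t then s else 0))" for s i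
  \<comment> \<open>The value of \<open>char_poly (- h i)\<close> at \<open>s\<close> is the determinant of \<open>h i + s\<close>.\<close>
  define Q where "Q = (\<Prod>i=1..n. char_poly (- h i))"
  define q where "q = (\<Sum>w\<in>W. smult (c w) (\<Prod>j\<in>J w.
      [: x (u w j), if fst (snd (u w j)) = snd (snd (u w j)) then 1 else 0 :]))"
  have h: "- h i \<in> carrier_mat (d i) (d i)" for i by (simp add: h_def)
  have h': "h' s i \<in> carrier_mat (d i) (d i)" for s i by (simp add: h'_def)
  have det: "poly (char_poly (- h i)) s = det (h' s i)" for i s
    unfolding char_poly_def
    by (rule poly_det_cong[OF h' char_poly_matrix_closed[OF h]])
      (auto simp: char_poly_matrix_def h_def h'_def)
  have q_eval: "poly q s = (\<Sum>w\<in>W. c w * (\<Prod>j\<in>J w. h' s (fst (u w j)) $$ snd (u w j)))" for s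
    unfolding q_def poly_sum poly_smult poly_prod
    using u by (intro sum.cong refl arg_cong2[where f = times] prod.cong) (force simp: h'_def)+
  have "poly (q * Q) s = 0" for s
  proof (cases "poly Q s = 0")
    case False
    then have "h' s i \<in> Units (ring_mat TYPE('k) (d i) ())" if "i \<in> {1..n}" for i
      using that by (intro det_non_zero_imp_unit[OF h']) (auto simp: Q_def poly_prod det)
    then have "restrict (h' s) {1..n} \<in> GL_prod n d" unfolding GL_prod_def by auto
    from zero[OF this]
    have "(\<Sum>w\<in>W. c w * (\<Prod>j\<in>J w. restrict (h' s) {1..n} (fst (u w j)) $$ snd (u w j))) = 0" .
    moreover have "(\<Prod>j\<in>J w. restrict (h' s) {1..n} (fst (u w j)) $$ snd (u w j)) =
        (\<Prod>j\<in>J w. h' s (fst (u w j)) $$ snd (u w j))" if "w \<in> W" for w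
    proof (rule prod.cong[OF refl])
      fix j assume "j \<in> J w"
      then have "fst (u w j) \<in> {1..n}" using u[OF that, of j] by (cases "u w j") auto
      then show "restrict (h' s) {1..n} (fst (u w j)) $$ snd (u w j) = h' s (fst (u w j)) $$ snd (u w j)"
        by simp
    qed
    ultimately have "poly q s = 0" unfolding q_eval by simp
    then show ?thesis by simp
  qed simp
  then have "q * Q = 0" using poly_all_0_iff_0 by blast
  moreover have "char_poly (- h i) \<noteq> 0" for i
    using degree_monic_char_poly[OF h[of i]] by auto
  then have "Q \<noteq> 0" unfolding Q_def by simp
  ultimately have "q = 0" by simp
  then have "poly q 0 = 0" by simp
  then show ?thesis unfolding q_def poly_sum poly_smult poly_prod by simp
qed

text \<open>
  Equal monomials contain each entry of \<open>g\<^sub>i\<close> equally often, which gives a permutation of the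
  positions for each \<open>i\<close> separately. This is where the \<open>n\<close> symmetric groups come from.
\<close>

lemma same_monomials_imp_slot_act:
  fixes x y x' y' :: "nat \<Rightarrow> nat \<Rightarrow> nat"
  assumes X: "x \<in> slot_tuples n d l" "y \<in> slot_tuples n d l"
      "x' \<in> slot_tuples n d l" "y' \<in> slot_tuples n d l"
    and eq: "\<forall>v :: nat \<times> nat \<times> nat \<Rightarrow> 'k::field_char_0.
      (\<Prod>t\<in>{1..n} \<times> {1..l}. v (fst t, y (snd t) (fst t), x (snd t) (fst t))) =
      (\<Prod>t\<in>{1..n} \<times> {1..l}. v (fst t, y' (snd t) (fst t), x' (snd t) (fst t)))"
  shows "\<exists>\<sigma>. (\<forall>i\<in>{1..n}. \<sigma> i permutes {1..l}) \<and> x = slot_act n l \<sigma> x' \<and> y = slot_act n l \<sigma> y'"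
proof -
  have "\<exists>\<pi>. \<pi> permutes {1..l} \<and> (\<forall>j\<in>{1..l}. (y j i, x j i) = (y' (\<pi> j) i, x' (\<pi> j) i))"
    if i: "i \<in> {1..n}" for i
  proof -
    have card: "card {t \<in> {1..n} \<times> {1..l}. (fst t, b (snd t) (fst t), a (snd t) (fst t)) \<in> {(i, v)}} =
        card {j \<in> {1..l}. (b j i, a j i) = v}" for a b v
      using i by (intro bij_betw_same_card[of snd] bij_betw_byWitness[where f' = "Pair i"]) auto
    have "card {j \<in> {1..l}. (y j i, x j i) = v} = card {j \<in> {1..l}. (y' j i, x' j i) = v}" for v
      unfolding card[symmetric] by (rule monomial_eq_imp_card_eq[OF spec[OF eq]]) auto
    then obtain \<pi> where "\<pi> permutes {1..l}" "\<And>j. j \<in> {1..l} \<Longrightarrow> (y j i, x j i) = (y' (\<pi> j) i, x' (\<pi> j) i)"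
      by (rule same_fibre_cards_imp_permutes[OF finite_atLeastAtMost]) blast
    then show ?thesis by blast
  qed
  then obtain \<sigma> where \<sigma>: "\<And>i. i \<in> {1..n} \<Longrightarrow> \<sigma> i permutes {1..l}"
    "\<And>i j. i \<in> {1..n} \<Longrightarrow> j \<in> {1..l} \<Longrightarrow> (y j i, x j i) = (y' (\<sigma> i j) i, x' (\<sigma> i j) i)"
    by metis
  have mem: "slot_act n l \<sigma> a \<in> slot_tuples n d l" if "a \<in> slot_tuples n d l" for a
    by (rule slot_act_mem[OF _ that]) (rule \<sigma>(1))
  show ?thesis
  proof (intro exI[of _ \<sigma>] conjI)
    show "x = slot_act n l \<sigma> x'"
      by (rule slot_tuple_eqI[OF X(1) mem[OF X(3)]]) (use \<sigma>(2) in \<open>simp add: slot_act_def\<close>)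
    show "y = slot_act n l \<sigma> y'"
      by (rule slot_tuple_eqI[OF X(2) mem[OF X(4)]]) (use \<sigma>(2) in \<open>simp add: slot_act_def\<close>)
  qed (use \<sigma>(1) in blast)
qed

text \<open>
  An entry of the commutator of \<open>F\<close> with the transposed tensor power of \<open>g\<close> is a polynomial in the entries of \<open>g\<close>.
  It vanishes identically, and an invariant matrix \<open>C\<close> is constant on the positions with a given
  monomial; so the same combination with the entries of \<open>C\<close> in place of the monomials vanishes.
\<close>

lemma commutes_with_invariant_kernels:
  fixes F C :: "(nat \<Rightarrow> nat \<Rightarrow> nat) \<Rightarrow> (nat \<Rightarrow> nat \<Rightarrow> nat) \<Rightarrow> 'k::field_char_0"
  assumes GL: "\<And>g x y. g \<in> GL_prod n d \<Longrightarrow> x \<in> slot_tuples n d l \<Longrightarrow> y \<in> slot_tuples n d l \<Longrightarrow>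
      (\<Sum>z\<in>slot_tuples n d l. slot_kernel l (simple_tensor n d g) x z * F z y) =
      (\<Sum>z\<in>slot_tuples n d l. F x z * slot_kernel l (simple_tensor n d g) z y)"
    and C: "\<And>\<sigma> x y. \<forall>i\<in>{1..n}. \<sigma> i permutes {1..l} \<Longrightarrow> x \<in> slot_tuples n d l \<Longrightarrow> y \<in> slot_tuples n d l \<Longrightarrow>
      C (slot_act n l \<sigma> x) (slot_act n l \<sigma> y) = C x y"
    and x: "x \<in> slot_tuples n d l" and y: "y \<in> slot_tuples n d l"
  shows "(\<Sum>z\<in>slot_tuples n d l. C x z * F z y) = (\<Sum>z\<in>slot_tuples n d l. F x z * C z y)"
proof -
  let ?X = "slot_tuples n d l"
  have fin: "finite ?X" by (intro finite_PiE finite_multi_indices) auto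
  \<comment> \<open>The two sums of the commutator become one sum over pairs with a flag \<open>b\<close>: \<open>p\<close> is the position in
    the tensor power and \<open>e\<close> the signed entry of \<open>F\<close>.\<close>
  define p where "p = (\<lambda>(b, z). if b then (x, z) else (z, y))"
  define e where "e = (\<lambda>(b, z). if b then F z y else - F x z)"
  define u where "u q t = (fst t :: nat, snd (p q) (snd t) (fst t), fst (p q) (snd t) (fst t))" for q and t :: "nat \<times> nat"
  let ?W = "(UNIV :: bool set) \<times> ?X" and ?J = "{1..n} \<times> {1..l}"
  have split: "(\<Sum>q\<in>?W. e q * h (p q)) = (\<Sum>z\<in>?X. h (x, z) * F z y) - (\<Sum>z\<in>?X. F x z * h (z, y))" for h
    unfolding sum.cartesian_product' UNIV_bool
    by (simp add: e_def p_def sum_negf mult.commute)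
  have pX: "fst (p q) \<in> ?X" "snd (p q) \<in> ?X" if "q \<in> ?W" for q
    using that x y by (auto simp: p_def split: prod.splits)
  have zero: "(\<Sum>q\<in>?W. e q * (\<Prod>t\<in>?J. v (u q t))) = 0" for v
  proof (rule polynomial_vanishing_on_GL_prod[where c = e and u = u and x = v and W = ?W and J = "\<lambda>_. ?J" and d = d and n = n])
    fix q t assume q: "q \<in> ?W" and t: "t \<in> ?J"
    have "fst (p q) (snd t) \<in> multi_indices n d" "snd (p q) (snd t) \<in> multi_indices n d"
      using t PiE_mem[OF pX(1)[OF q], of "snd t"]
        PiE_mem[OF pX(2)[OF q], of "snd t"] by auto
    then show "u q t \<in> (SIGMA i:{1..n}. {..<d i} \<times> {..<d i})"
      using t unfolding u_def multi_indices_def by (auto simp: PiE_iff)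
  next
    fix g :: "nat \<Rightarrow> 'k mat" assume g: "g \<in> GL_prod n d"
    let ?k = "\<lambda>q. slot_kernel l (simple_tensor n d g) (fst q) (snd q)"
    have "(\<Prod>t\<in>?J. g (fst (u q t)) $$ snd (u q t)) = ?k (p q)" if "q \<in> ?W" for q
      using pX[OF that]
      by (simp only: slot_kernel_simple_tensor) (simp add: u_def prod.cartesian_product case_prod_unfold)
    then have "(\<Sum>q\<in>?W. e q * (\<Prod>t\<in>?J. g (fst (u q t)) $$ snd (u q t))) = (\<Sum>q\<in>?W. e q * ?k (p q))"
      by (intro sum.cong[OF refl]) simp
    also have "\<dots> = 0" using split[of ?k] GL[OF g x y] by simp
    finally show "(\<Sum>q\<in>?W. e q * (\<Prod>t\<in>?J. g (fst (u q t)) $$ snd (u q t))) = 0" .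
  qed
  have "(\<Sum>q\<in>?W. e q * C (fst (p q)) (snd (p q))) = 0"
  proof (rule sum_constant_on_monomials_eq_0[where c = e and h = "\<lambda>q. C (fst (p q)) (snd (p q))" and u = u and J = "\<lambda>_. ?J", OF _ zero])
    show "finite ?W" using fin by simp
    fix q q' assume q: "q \<in> ?W" and q': "q' \<in> ?W"
      and eq: "\<forall>v :: _ \<Rightarrow> 'k. (\<Prod>t\<in>?J. v (u q t)) = (\<Prod>t\<in>?J. v (u q' t))"
    have "\<exists>\<sigma>. (\<forall>i\<in>{1..n}. \<sigma> i permutes {1..l}) \<and>
        fst (p q) = slot_act n l \<sigma> (fst (p q')) \<and> snd (p q) = slot_act n l \<sigma> (snd (p q'))"
      by (rule same_monomials_imp_slot_act[OF pX(1)[OF q] pX(2)[OF q]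
            pX(1)[OF q'] pX(2)[OF q'] eq[unfolded u_def]])
    then obtain \<sigma> where "\<forall>i\<in>{1..n}. \<sigma> i permutes {1..l}"
        "fst (p q) = slot_act n l \<sigma> (fst (p q'))" "snd (p q) = slot_act n l \<sigma> (snd (p q'))"
      by (elim exE conjE)
    then show "C (fst (p q)) (snd (p q)) = C (fst (p q')) (snd (p q'))"
      using C[of \<sigma>, OF _ pX[OF q']] by (simp only:)
  qed
  then show ?thesis
    using split[of "\<lambda>q. C (fst q) (snd q)"] by simp
qed

text \<open>
  Schur-Weyl duality for the product of general linear groups. The matrices invariant under \<open>S\<^sub>l\<^sup>n\<close>
  are those invariant under the finite group of permutations of the tuples that \<open>S\<^sub>l\<^sup>n\<close> induces, so
  the double commutant theorem applies to this group.
\<close>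

theorem GL_commutant_spanned_by_slot_acts:
  fixes F :: "(nat \<Rightarrow> nat \<Rightarrow> nat) \<Rightarrow> (nat \<Rightarrow> nat \<Rightarrow> nat) \<Rightarrow> 'k::field_char_0"
  assumes GL: "\<And>g x y. g \<in> GL_prod n d \<Longrightarrow> x \<in> slot_tuples n d l \<Longrightarrow> y \<in> slot_tuples n d l \<Longrightarrow>
      (\<Sum>z\<in>slot_tuples n d l. slot_kernel l (simple_tensor n d g) x z * F z y) =
      (\<Sum>z\<in>slot_tuples n d l. F x z * slot_kernel l (simple_tensor n d g) z y)"
  shows "\<exists>\<Sigma> c. finite \<Sigma> \<and> (\<forall>\<sigma>\<in>\<Sigma>. \<forall>i\<in>{1..n}. \<sigma> i permutes {1..l}) \<and>
    (\<forall>x\<in>slot_tuples n d l. \<forall>y\<in>slot_tuples n d l. F x y = (\<Sum>\<sigma>\<in>\<Sigma>. c \<sigma> * of_bool (y = slot_act n l \<sigma> x)))"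
proof -
  let ?X = "slot_tuples n d l"
  have fin: "finite ?X" by (intro finite_PiE finite_multi_indices) auto
  \<comment> \<open>Different \<open>\<sigma>\<close> may act in the same way, so the permutations of the tuples are taken as the group,
    and a representative \<open>s \<gamma>\<close> is chosen for each of them.\<close>
  define \<Gamma> where "\<Gamma> = {\<gamma>. \<gamma> permutes ?X \<and>
    (\<exists>\<sigma>. (\<forall>i\<in>{1..n}. \<sigma> i permutes {1..l}) \<and> (\<forall>x\<in>?X. \<gamma> x = slot_act n l \<sigma> x))}"
  have \<Gamma>I: "\<gamma> \<in> \<Gamma>" if "\<gamma> permutes ?X" "\<forall>i\<in>{1..n}. \<sigma> i permutes {1..l}" "\<forall>x\<in>?X. \<gamma> x = slot_act n l \<sigma> x" for \<gamma> \<sigma>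
    using that unfolding \<Gamma>_def by blast
  have perm: "\<gamma> permutes ?X" if "\<gamma> \<in> \<Gamma>" for \<gamma> using that unfolding \<Gamma>_def by blast
  have "\<forall>\<gamma>\<in>\<Gamma>. \<exists>\<sigma>. (\<forall>i\<in>{1..n}. \<sigma> i permutes {1..l}) \<and> (\<forall>x\<in>?X. \<gamma> x = slot_act n l \<sigma> x)"
    unfolding \<Gamma>_def by (intro ballI) (elim CollectE conjE)
  from bchoice[OF this] obtain s where
    "\<forall>\<gamma>\<in>\<Gamma>. (\<forall>i\<in>{1..n}. s \<gamma> i permutes {1..l}) \<and> (\<forall>x\<in>?X. \<gamma> x = slot_act n l (s \<gamma>) x)"
    by (elim exE)
  then have s: "\<And>\<gamma>. \<gamma> \<in> \<Gamma> \<Longrightarrow> \<forall>i\<in>{1..n}. s \<gamma> i permutes {1..l}"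
      "\<And>\<gamma> x. \<gamma> \<in> \<Gamma> \<Longrightarrow> x \<in> ?X \<Longrightarrow> \<gamma> x = slot_act n l (s \<gamma>) x"
    by blast+
  have mem: "\<gamma> x \<in> ?X" if "\<gamma> \<in> \<Gamma>" "x \<in> ?X" for \<gamma> x
    using permutes_in_image[OF perm[OF that(1)]] that(2) by blast
  have id: "id \<in> \<Gamma>"
    by (rule \<Gamma>I[of _ "\<lambda>i. id"]) (auto simp: permutes_id slot_act_id[of _ _ n d])
  have comp: "\<gamma> \<circ> \<delta> \<in> \<Gamma>" if \<gamma>: "\<gamma> \<in> \<Gamma>" and \<delta>: "\<delta> \<in> \<Gamma>" for \<gamma> \<delta>
  proof (rule \<Gamma>I[of _ "\<lambda>i. s \<delta> i \<circ> s \<gamma> i"])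
    show "\<gamma> \<circ> \<delta> permutes ?X" by (rule permutes_compose[OF perm[OF \<delta>] perm[OF \<gamma>]])
    show "\<forall>i\<in>{1..n}. (s \<delta> i \<circ> s \<gamma> i) permutes {1..l}"
      using s(1)[OF \<gamma>] s(1)[OF \<delta>] by (auto intro: permutes_compose)
    show "\<forall>x\<in>?X. (\<gamma> \<circ> \<delta>) x = slot_act n l (\<lambda>i. s \<delta> i \<circ> s \<gamma> i) x"
    proof
      fix x assume x: "x \<in> ?X"
      have "(\<gamma> \<circ> \<delta>) x = slot_act n l (s \<gamma>) (slot_act n l (s \<delta>) x)"
        using s(2)[OF \<gamma> mem[OF \<delta> x]] s(2)[OF \<delta> x] by simp
      also have "\<dots> = slot_act n l (\<lambda>i. s \<delta> i \<circ> s \<gamma> i) x"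
        by (rule slot_act_comp) (use s(1)[OF \<gamma>] in blast)
      finally show "(\<gamma> \<circ> \<delta>) x = slot_act n l (\<lambda>i. s \<delta> i \<circ> s \<gamma> i) x" .
    qed
  qed
  have inv: "Hilbert_Choice.inv \<gamma> \<in> \<Gamma>" if \<gamma>: "\<gamma> \<in> \<Gamma>" for \<gamma>
  proof (rule \<Gamma>I[of _ "\<lambda>i. Hilbert_Choice.inv (s \<gamma> i)"])
    show "Hilbert_Choice.inv \<gamma> permutes ?X" by (rule permutes_inv[OF perm[OF \<gamma>]])
    show ps: "\<forall>i\<in>{1..n}. Hilbert_Choice.inv (s \<gamma> i) permutes {1..l}"
      using s(1)[OF \<gamma>] by (auto intro: permutes_inv)
    show "\<forall>x\<in>?X. Hilbert_Choice.inv \<gamma> x = slot_act n l (\<lambda>i. Hilbert_Choice.inv (s \<gamma> i)) x"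
    proof
      fix x assume x: "x \<in> ?X"
      let ?y = "slot_act n l (\<lambda>i. Hilbert_Choice.inv (s \<gamma> i)) x"
      have y: "?y \<in> ?X" using x by (intro slot_act_mem) (use ps in blast)
      have "\<gamma> ?y = slot_act n l (s \<gamma>) ?y" by (rule s(2)[OF \<gamma> y])
      also have "\<dots> = x" using x
        by (intro slot_act_inverse) (use s(1)[OF \<gamma>] in blast)
      finally show "Hilbert_Choice.inv \<gamma> x = ?y"
        using permutes_inverses(2)[OF perm[OF \<gamma>], of ?y] by simp
    qed
  qed
  obtain c where c: "\<And>x y. x \<in> ?X \<Longrightarrow> y \<in> ?X \<Longrightarrow> F x y = (\<Sum>\<gamma>\<in>\<Gamma>. c \<gamma> * of_bool (y = \<gamma> x))"
  proof (rule bicommutant_permutation_group[where F = F, OF fin perm id comp inv])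
    fix C :: "(nat \<Rightarrow> nat \<Rightarrow> nat) \<Rightarrow> (nat \<Rightarrow> nat \<Rightarrow> nat) \<Rightarrow> 'k" and x y
    assume C: "\<And>\<gamma> x y. \<gamma> \<in> \<Gamma> \<Longrightarrow> x \<in> ?X \<Longrightarrow> y \<in> ?X \<Longrightarrow> C (\<gamma> x) (\<gamma> y) = C x y"
      and x: "x \<in> ?X" and y: "y \<in> ?X"
    have "C (slot_act n l \<sigma> x) (slot_act n l \<sigma> y) = C x y"
      if \<sigma>: "\<forall>i\<in>{1..n}. \<sigma> i permutes {1..l}" and x: "x \<in> ?X" and y: "y \<in> ?X" for \<sigma> x y
    proof -
      define \<gamma> where "\<gamma> = (\<lambda>x. if x \<in> ?X then slot_act n l \<sigma> x else x)"
      have "bij_betw (slot_act n l \<sigma>) ?X ?X" by (rule slot_act_bij) (use \<sigma> in blast)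
      then have "bij_betw \<gamma> ?X ?X" by (subst bij_betw_cong[of _ _ "slot_act n l \<sigma>"]) (simp_all add: \<gamma>_def)
      then have "\<gamma> permutes ?X" by (rule bij_imp_permutes) (simp add: \<gamma>_def)
      then have "\<gamma> \<in> \<Gamma>" by (rule \<Gamma>I[OF _ \<sigma>]) (simp add: \<gamma>_def)
      from C[OF this x y] show ?thesis using x y by (simp add: \<gamma>_def)
    qed
    note C_inv = this
    show "(\<Sum>z\<in>?X. C x z * F z y) = (\<Sum>z\<in>?X. F x z * C z y)"
    proof (rule commutes_with_invariant_kernels[where C = C and F = F])
      show "x \<in> slot_tuples n d l" "y \<in> slot_tuples n d l"
        using x y by simp_all
    qed (rule GL C_inv; assumption)+
  qed blast+
  have fin\<Gamma>: "finite \<Gamma>" using finite_subset[OF _ finite_permutations[OF fin]] perm by blast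
  show ?thesis
  proof (intro exI[of _ "s ` \<Gamma>"] exI[of _ "\<lambda>\<sigma>. \<Sum>\<gamma> | \<gamma> \<in> \<Gamma> \<and> s \<gamma> = \<sigma>. c \<gamma>"] conjI ballI)
    show "finite (s ` \<Gamma>)" using fin\<Gamma> by simp
    show "\<sigma> i permutes {1..l}" if "\<sigma> \<in> s ` \<Gamma>" "i \<in> {1..n}" for \<sigma> i using that s(1) by blast
    fix x y assume x: "x \<in> ?X" and y: "y \<in> ?X"
    have "(\<Sum>\<sigma>\<in>s ` \<Gamma>. (\<Sum>\<gamma> | \<gamma> \<in> \<Gamma> \<and> s \<gamma> = \<sigma>. c \<gamma>) * of_bool (y = slot_act n l \<sigma> x)) =
        (\<Sum>\<sigma>\<in>s ` \<Gamma>. \<Sum>\<gamma> | \<gamma> \<in> \<Gamma> \<and> s \<gamma> = \<sigma>. c \<gamma> * of_bool (y = \<gamma> x))"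
      unfolding sum_distrib_right using s(2)[OF _ x] by (intro sum.cong[OF refl]) auto
    also have "\<dots> = (\<Sum>\<gamma>\<in>\<Gamma>. c \<gamma> * of_bool (y = \<gamma> x))"
      using fin\<Gamma> by (intro sum.group) auto
    finally show "F x y = (\<Sum>\<sigma>\<in>s ` \<Gamma>. (\<Sum>\<gamma> | \<gamma> \<in> \<Gamma> \<and> s \<gamma> = \<sigma>. c \<gamma>) * of_bool (y = slot_act n l \<sigma> x))"
      using c[OF x y] by simp
  qed
qed

section \<open>Polynomials with symmetric coefficients\<close>

lemma algebra_generated_extensional:
  "f \<in> algebra_generated W S \<Longrightarrow> f \<in> extensional W"
  by (induction rule: algebra_generated.induct) (auto simp: extensional_def)

lemma algebra_generated_sum:
  assumes "finite I" and "\<And>i. i \<in> I \<Longrightarrow> (\<lambda>w\<in>W. f i w) \<in> algebra_generated W S"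
  shows "(\<lambda>w\<in>W. \<Sum>i\<in>I. f i w) \<in> algebra_generated W S"
  using assms
proof (induction I rule: finite_induct)
  case (insert i I)
  have "(\<lambda>w\<in>W. (\<lambda>w\<in>W. f i w) w + (\<lambda>w\<in>W. \<Sum>i\<in>I. f i w) w) \<in> algebra_generated W S"
    using insert.IH insert.prems by (intro algebra_generated.add) blast+
  moreover have "(\<lambda>w\<in>W. (\<lambda>w\<in>W. f i w) w + (\<lambda>w\<in>W. \<Sum>i\<in>I. f i w) w) = (\<lambda>w\<in>W. \<Sum>i\<in>insert i I. f i w)"
    using insert.hyps by (intro restrict_ext) simp
  ultimately show ?case by (simp only:)
qed (simp add: algebra_generated.const)

lemma algebra_generated_prod:
  assumes "finite I" and "\<And>i. i \<in> I \<Longrightarrow> (\<lambda>w\<in>W. f i w) \<in> algebra_generated W S"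
  shows "(\<lambda>w\<in>W. \<Prod>i\<in>I. f i w) \<in> algebra_generated W S"
  using assms
proof (induction I rule: finite_induct)
  case (insert i I)
  have "(\<lambda>w\<in>W. (\<lambda>w\<in>W. f i w) w * (\<lambda>w\<in>W. \<Prod>i\<in>I. f i w) w) \<in> algebra_generated W S"
    using insert.IH insert.prems by (intro algebra_generated.mult) blast+
  moreover have "(\<lambda>w\<in>W. (\<lambda>w\<in>W. f i w) w * (\<lambda>w\<in>W. \<Prod>i\<in>I. f i w) w) = (\<lambda>w\<in>W. \<Prod>i\<in>insert i I. f i w)"
    using insert.hyps by (intro restrict_ext) simp
  ultimately show ?case by (simp only:)
qed (simp add: algebra_generated.const)

lemma algebra_generated_scale:
  assumes "(\<lambda>w\<in>W. f w) \<in> algebra_generated W S"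
  shows "(\<lambda>w\<in>W. c * f w) \<in> algebra_generated W S"
proof -
  have "(\<lambda>w\<in>W. (\<lambda>w\<in>W. c) w * (\<lambda>w\<in>W. f w) w) \<in> algebra_generated W S"
    by (intro algebra_generated.mult algebra_generated.const assms)
  moreover have "(\<lambda>w\<in>W. (\<lambda>w\<in>W. c) w * (\<lambda>w\<in>W. f w) w) = (\<lambda>w\<in>W. c * f w)"
    by (intro restrict_ext) simp
  ultimately show ?thesis by (simp only:)
qed

lemma sum_list_combine_terms:
  fixes e :: "'v \<Rightarrow> 'k::comm_semiring_1"
  shows "(\<Sum>(c, vs)\<leftarrow>concat (map (\<lambda>(c, vs). map (\<lambda>(c', vs'). (c * c', vs @ vs')) ts') ts).
      c * prod_list (map e vs)) =
    (\<Sum>(c, vs)\<leftarrow>ts. c * prod_list (map e vs)) * (\<Sum>(c, vs)\<leftarrow>ts'. c * prod_list (map e vs))"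
proof (induction ts)
  case (Cons t ts)
  have "(\<Sum>(c', vs')\<leftarrow>map (\<lambda>(c', vs'). (fst t * c', snd t @ vs')) ts'. c' * prod_list (map e vs')) =
      (fst t * prod_list (map e (snd t))) * (\<Sum>(c, vs)\<leftarrow>ts'. c * prod_list (map e vs))"
    by (induction ts') (auto simp: algebra_simps)
  then show ?case using Cons by (simp add: case_prod_unfold distrib_right)
qed simp

text \<open>
  Terms are kept in a list, without collecting equal monomials, so that sums and products of polynomials
  are concatenations.
\<close>

lemma polynomial_as_term_list:
  assumes "f \<in> algebra_generated W {\<lambda>w. e w v | v. v \<in> V}"
  shows "\<exists>ts. (\<forall>(c, vs)\<in>set ts. set vs \<subseteq> V) \<and>
    (\<forall>w\<in>W. f w = (\<Sum>(c, vs)\<leftarrow>ts. c * prod_list (map (e w) vs)))"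
  using assms
proof (induction rule: algebra_generated.induct)
  case (const c)
  then show ?case by (intro exI[of _ "[(c, [])]"]) auto
next
  case (gen f)
  then obtain v where "v \<in> V" "f = (\<lambda>w. e w v)" by blast
  then show ?case by (intro exI[of _ "[(1, [v])]"]) auto
next
  case (add f h)
  then obtain ts ts' where "\<forall>(c, vs)\<in>set ts. set vs \<subseteq> V" "\<forall>(c, vs)\<in>set ts'. set vs \<subseteq> V"
    "\<forall>w\<in>W. f w = (\<Sum>(c, vs)\<leftarrow>ts. c * prod_list (map (e w) vs))"
    "\<forall>w\<in>W. h w = (\<Sum>(c, vs)\<leftarrow>ts'. c * prod_list (map (e w) vs))" by blast
  then show ?case by (intro exI[of _ "ts @ ts'"]) auto
next
  case (mult f h)
  then obtain ts ts' where ts: "\<forall>(c, vs)\<in>set ts. set vs \<subseteq> V" "\<forall>(c, vs)\<in>set ts'. set vs \<subseteq> V"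
    and eq: "\<forall>w\<in>W. f w = (\<Sum>(c, vs)\<leftarrow>ts. c * prod_list (map (e w) vs))"
    "\<forall>w\<in>W. h w = (\<Sum>(c, vs)\<leftarrow>ts'. c * prod_list (map (e w) vs))" by blast
  show ?case
  proof (intro exI conjI)
    let ?ts = "concat (map (\<lambda>(c, vs). map (\<lambda>(c', vs'). (c * c', vs @ vs')) ts') ts)"
    show "\<forall>(c, vs)\<in>set ?ts. set vs \<subseteq> V" using ts by fastforce
    show "\<forall>w\<in>W. (\<lambda>w\<in>W. f w * h w) w = (\<Sum>(c, vs)\<leftarrow>?ts. c * prod_list (map (e w) vs))"
      using eq by (simp add: sum_list_combine_terms)
  qed
qed

text \<open>
  \<open>F l u\<close> is the coefficient of the word \<open>u\<close> of length \<open>l\<close>, a product of \<open>l\<close> variables in a chosen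
  order; it must not depend on that order.
\<close>

definition symmetric_coeffs :: "'v set \<Rightarrow> (nat \<Rightarrow> (nat \<Rightarrow> 'v) \<Rightarrow> 'k::field) \<Rightarrow> bool" where
  "symmetric_coeffs V F \<longleftrightarrow> (\<forall>l \<pi>. \<pi> permutes {1..l} \<longrightarrow> (\<forall>u\<in>{1..l} \<rightarrow>\<^sub>E V. F l (u \<circ> \<pi>) = F l u))"

text \<open>
  The coefficient of a monomial is distributed evenly over all rearrangements of its variables, which
  needs division by \<open>l!\<close>. It is stated for all valuations \<open>e\<close> at once because the coefficients must not
  depend on the point.
\<close>

lemma symmetrized_monomial:
  fixes c :: "'k::field_char_0" and vs :: "'v list"
  assumes V: "finite V" and vs: "set vs \<subseteq> V"
  shows "\<exists>F. symmetric_coeffs V F \<and> (\<forall>l>length vs. F l = (\<lambda>_. 0)) \<and>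
    (\<forall>e. c * prod_list (map e vs) =
      (\<Sum>l\<le>length vs. \<Sum>u\<in>{1..l} \<rightarrow>\<^sub>E V. F l u * (\<Prod>j=1..l. e (u j))))"
proof -
  define k where "k = length vs"
  define w where "w \<pi> = (\<lambda>j\<in>{1..k}. vs ! (\<pi> j - 1))" for \<pi> :: "nat \<Rightarrow> nat"
  let ?P = "{\<pi>. \<pi> permutes {1..k}}"
  define F where "F l u = (if l = k then c / fact k * (\<Sum>\<pi>\<in>?P. of_bool (u = w \<pi>)) else 0)" for l u
  have w_comp: "w (\<pi> \<circ> \<rho>) = w \<pi> \<circ> \<rho>" if "\<rho> permutes {1..k}" for \<pi> \<rho>
    using permutes_in_image[OF that] by (auto simp: w_def fun_eq_iff restrict_def)
  have sym: "F l (u \<circ> \<rho>) = F l u" if \<rho>: "\<rho> permutes {1..l}" for l u \<rho>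
  proof (cases "l = k")
    case True
    have "(\<Sum>\<pi>\<in>?P. of_bool (u \<circ> \<rho> = w \<pi>) :: 'k) = (\<Sum>\<pi>\<in>?P. of_bool (u \<circ> \<rho> = w (\<pi> \<circ> \<rho>)))"
      using \<rho> True by (intro sum_permutations_compose_right) simp
    also have "\<dots> = (\<Sum>\<pi>\<in>?P. of_bool (u = w \<pi>))"
    proof (rule sum.cong[OF refl])
      fix \<pi>
      have "u \<circ> \<rho> = w \<pi> \<circ> \<rho> \<longleftrightarrow> u = w \<pi>"
        using permutes_inv_o(1)[OF \<rho>] by (metis comp_assoc comp_id)
      then show "of_bool (u \<circ> \<rho> = w (\<pi> \<circ> \<rho>)) = (of_bool (u = w \<pi>) :: 'k)"
        using w_comp[of \<rho> \<pi>] \<rho> True by simp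
    qed
    finally show ?thesis by (simp add: F_def)
  qed (simp add: F_def)
  have w_mem: "w \<pi> \<in> {1..k} \<rightarrow>\<^sub>E V" if \<pi>: "\<pi> permutes {1..k}" for \<pi>
  proof -
    have "vs ! (\<pi> j - 1) \<in> V" if "j \<in> {1..k}" for j
      using permutes_in_image[OF \<pi>, of j] that vs by (intro subsetD[OF vs] nth_mem) (auto simp: k_def)
    then show ?thesis by (auto simp: w_def)
  qed
  have eval: "c * prod_list (map e vs) = (\<Sum>l\<le>k. \<Sum>u\<in>{1..l} \<rightarrow>\<^sub>E V. F l u * (\<Prod>j=1..l. e (u j)))" for e
  proof -
    have fin: "finite ({1..k} \<rightarrow>\<^sub>E V)" using V by (intro finite_PiE) auto
    have prod_w: "(\<Prod>j=1..k. e (w \<pi> j)) = prod_list (map e vs)" if \<pi>: "\<pi> permutes {1..k}" for \<pi>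
    proof -
      have "(\<Prod>j=1..k. e (w \<pi> j)) = (\<Prod>j=1..k. ((\<lambda>j. e (vs ! (j - 1))) \<circ> \<pi>) j)"
        by (intro prod.cong[OF refl]) (simp add: w_def)
      also have "\<dots> = (\<Prod>j=1..k. e (vs ! (j - 1)))" by (rule prod.permute[OF \<pi>, symmetric])
      also have "\<dots> = (\<Prod>j=0..<k. e (vs ! j))"
        by (rule prod.reindex_bij_witness[of _ Suc "\<lambda>j. j - 1"]) auto
      also have "\<dots> = prod_list (map e vs)"
        unfolding k_def by (simp add: prod.list_conv_set_nth)
      finally show ?thesis .
    qed
    have "(\<Sum>l\<le>k. \<Sum>u\<in>{1..l} \<rightarrow>\<^sub>E V. F l u * (\<Prod>j=1..l. e (u j))) =
        (\<Sum>l\<le>k. if l = k then \<Sum>u\<in>{1..k} \<rightarrow>\<^sub>E V. F k u * (\<Prod>j=1..k. e (u j)) else 0)"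
      by (intro sum.cong[OF refl]) (auto simp: F_def)
    also have "\<dots> = (\<Sum>u\<in>{1..k} \<rightarrow>\<^sub>E V. F k u * (\<Prod>j=1..k. e (u j)))" by simp
    also have "\<dots> = (\<Sum>u\<in>{1..k} \<rightarrow>\<^sub>E V. \<Sum>\<pi>\<in>?P. c / fact k * (of_bool (u = w \<pi>) * (\<Prod>j=1..k. e (u j))))"
      by (simp add: F_def sum_distrib_left sum_distrib_right mult.assoc)
    also have "\<dots> = (\<Sum>\<pi>\<in>?P. \<Sum>u\<in>{1..k} \<rightarrow>\<^sub>E V. c / fact k * (of_bool (u = w \<pi>) * (\<Prod>j=1..k. e (u j))))"
      by (rule sum.swap)
    also have "\<dots> = (\<Sum>\<pi>\<in>?P. c / fact k * prod_list (map e vs))"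
    proof (rule sum.cong[OF refl])
      fix \<pi> assume "\<pi> \<in> ?P"
      then have \<pi>: "\<pi> permutes {1..k}" by simp
      have "(\<Sum>u\<in>{1..k} \<rightarrow>\<^sub>E V. c / fact k * (of_bool (u = w \<pi>) * (\<Prod>j=1..k. e (u j)))) =
          (\<Sum>u\<in>{1..k} \<rightarrow>\<^sub>E V. if u = w \<pi> then c / fact k * (\<Prod>j=1..k. e (u j)) else 0)"
        by (intro sum.cong[OF refl]) simp
      also have "\<dots> = c / fact k * (\<Prod>j=1..k. e (w \<pi> j))" using fin w_mem[OF \<pi>] by (simp del: One_nat_def)
      finally show "(\<Sum>u\<in>{1..k} \<rightarrow>\<^sub>E V. c / fact k * (of_bool (u = w \<pi>) * (\<Prod>j=1..k. e (u j)))) =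
          c / fact k * prod_list (map e vs)" unfolding prod_w[OF \<pi>] .
    qed
    also have "\<dots> = c * prod_list (map e vs)"
      using card_permutations[OF refl, of "{1..k}"] by simp
    finally show ?thesis by simp
  qed
  show ?thesis
    unfolding symmetric_coeffs_def k_def[symmetric]
    using sym eval by (intro exI[of _ F]) (auto simp: F_def fun_eq_iff)
qed

theorem polynomial_symmetric_normal_form:
  fixes e :: "'w \<Rightarrow> 'v \<Rightarrow> 'k::field_char_0"
  assumes f: "f \<in> algebra_generated W {\<lambda>w. e w v | v. v \<in> V}" and V: "finite V"
  shows "\<exists>L F. symmetric_coeffs V F \<and>
    (\<forall>w\<in>W. f w = (\<Sum>l\<le>L. \<Sum>u\<in>{1..l} \<rightarrow>\<^sub>E V. F l u * (\<Prod>j=1..l. e w (u j))))"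
proof -
  let ?S = "\<lambda>L F e. \<Sum>l\<le>L. \<Sum>u\<in>{1..l} \<rightarrow>\<^sub>E V. F l u * (\<Prod>j=1..l. e (u j))"
  obtain ts where ts: "\<forall>(c, vs)\<in>set ts. set vs \<subseteq> V"
    and f_eq: "\<forall>w\<in>W. f w = (\<Sum>(c, vs)\<leftarrow>ts. c * prod_list (map (e w) vs))"
    using polynomial_as_term_list[OF f] by blast
  have "\<exists>L F. symmetric_coeffs V F \<and> (\<forall>l>L. F l = (\<lambda>_. 0)) \<and>
      (\<forall>e. (\<Sum>(c, vs)\<leftarrow>ts. c * prod_list (map e vs)) = ?S L F e)"
    using ts
  proof (induction ts)
    case Nil
    show ?case by (intro exI[of _ 0] exI[of _ "\<lambda>_ _. 0"]) (simp add: symmetric_coeffs_def)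
  next
    case (Cons t ts)
    then obtain L F where F: "symmetric_coeffs V F" "\<forall>l>L. F l = (\<lambda>_. 0)"
      and F_eq: "\<And>e. (\<Sum>(c, vs)\<leftarrow>ts. c * prod_list (map e vs)) = ?S L F e" by auto
    obtain c vs where t: "t = (c, vs)" by fastforce
    with Cons.prems have "set vs \<subseteq> V" by simp
    from symmetrized_monomial[OF V this, of c] obtain G where G: "symmetric_coeffs V G"
      "\<forall>l>length vs. G l = (\<lambda>_. 0)" and G_eq: "\<And>e. c * prod_list (map e vs) = ?S (length vs) G e"
      by (elim exE conjE) blast
    let ?L = "max L (length vs)"
    have extend: "?S K H e = ?S ?L H e" if "K \<le> ?L" "\<forall>l>K. H l = (\<lambda>_. 0)"
      for K and H :: "nat \<Rightarrow> (nat \<Rightarrow> 'v) \<Rightarrow> 'k" and e :: "'v \<Rightarrow> 'k"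
      using that by (intro sum.mono_neutral_left) auto
    show ?case
    proof (intro exI[of _ ?L] exI[of _ "\<lambda>l u. F l u + G l u"] conjI allI)
      show "symmetric_coeffs V (\<lambda>l u. F l u + G l u)"
        using F(1) G(1) by (simp add: symmetric_coeffs_def)
      show "?L < l \<longrightarrow> (\<lambda>u. F l u + G l u) = (\<lambda>_. 0)" for l using F(2) G(2) by simp
      fix e
      have "(\<Sum>(c, vs)\<leftarrow>t # ts. c * prod_list (map e vs)) = ?S ?L G e + ?S ?L F e"
        using F_eq[of e] G_eq[of e] extend[of L F e] extend[of "length vs" G e] F(2) G(2)
        by (simp add: t)
      also have "\<dots> = ?S ?L (\<lambda>l u. F l u + G l u) e"
        by (simp add: distrib_right sum.distrib add.commute)
      finally show "(\<Sum>(c, vs)\<leftarrow>t # ts. c * prod_list (map e vs)) = ?S ?L (\<lambda>l u. F l u + G l u) e" .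
    qed
  qed
  then obtain L F where "symmetric_coeffs V F"
    "\<forall>e. (\<Sum>(c, vs)\<leftarrow>ts. c * prod_list (map e vs)) = ?S L F e" by blast
  then show ?thesis using f_eq by (intro exI[of _ L] exI[of _ F]) simp
qed

section \<open>Trace functions are invariant polynomials\<close>

lemma word_letter: "j \<in> {1..length P} \<Longrightarrow> P ! (j - 1) \<in> set P"
  by (intro nth_mem) auto

lemma tensor_trace_word_invariant:
  fixes M :: "nat \<Rightarrow> 'k::field tensor_mat"
  assumes P: "set P \<subseteq> {1..m}" and \<sigma>: "\<And>i. i \<in> {1..n} \<Longrightarrow> \<sigma> i permutes {1..length P}"
    and g: "g \<in> GL_prod n d" and M: "M \<in> End_power n d m"
  shows "tensor_trace_word n d P \<sigma> (simultaneous_conj n d m g M) = tensor_trace_word n d P \<sigma> M"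
proof -
  let ?g = "simple_tensor n d g"
  have letter: "P ! (j - 1) \<in> {1..m}" if "j \<in> {1..length P}" for j
    using word_letter[OF that] P by blast
  have "tensor_trace_word n d P \<sigma> (\<lambda>p\<in>{1..m}. tensor_mat_mult n d ?g (N p)) =
      tensor_trace_word n d P \<sigma> (\<lambda>p\<in>{1..m}. tensor_mat_mult n d (N p) ?g)"
    for N :: "nat \<Rightarrow> 'k tensor_mat"
  proof -
    have "tensor_trace_word n d P \<sigma> (\<lambda>p\<in>{1..m}. tensor_mat_mult n d ?g (N p)) =
        tensor_trace n d (length P) \<sigma> (\<lambda>j. tensor_mat_mult n d ?g (N (P ! (j - 1))))"
      unfolding tensor_trace_word_def using letter by (intro tensor_trace_cong) simp
    also have "\<dots> = tensor_trace n d (length P) \<sigma> (\<lambda>j. tensor_mat_mult n d (N (P ! (j - 1))) ?g)"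
      by (rule tensor_trace_mult_commute) (rule \<sigma>)
    also have "\<dots> = tensor_trace_word n d P \<sigma> (\<lambda>p\<in>{1..m}. tensor_mat_mult n d (N p) ?g)"
      unfolding tensor_trace_word_def using letter by (intro tensor_trace_cong) simp
    finally show ?thesis .
  qed
  then have "\<forall>M\<in>End_power n d m.
      tensor_trace_word n d P \<sigma> (simultaneous_conj n d m g M) = tensor_trace_word n d P \<sigma> M"
    unfolding conj_invariant_iff[OF g] by (intro ballI)
  then show ?thesis using M by (rule bspec)
qed

lemma tensor_trace_word_polynomial:
  assumes P: "set P \<subseteq> {1..m}" and \<sigma>: "\<And>i. i \<in> {1..n} \<Longrightarrow> \<sigma> i permutes {1..length P}"
  shows "restrict (tensor_trace_word n d P \<sigma> :: (nat \<Rightarrow> 'k::field tensor_mat) \<Rightarrow> 'k) (End_power n d m) \<in> polynomial_functions n d m"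
proof -
  let ?W = "End_power n d m" and ?X = "slot_tuples n d (length P)"
    and ?s = "slot_act n (length P) \<sigma>"
  have fin: "finite ?X" by (intro finite_PiE finite_multi_indices) auto
  have "tensor_trace_word n d P \<sigma> =
      (\<lambda>M :: nat \<Rightarrow> 'k tensor_mat. \<Sum>a\<in>?X. \<Prod>j=1..length P. M (P ! (j - 1)) (a j, ?s a j))"
    unfolding tensor_trace_word_def by (intro ext tensor_trace_eq) (rule \<sigma>)
  moreover have "(\<lambda>M\<in>?W. \<Sum>a\<in>?X. \<Prod>j=1..length P. M (P ! (j - 1)) (a j, ?s a j) :: 'k)
      \<in> polynomial_functions n d m"
    unfolding polynomial_functions_def
  proof (intro algebra_generated_sum algebra_generated_prod algebra_generated.gen fin finite_atLeastAtMost)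
    fix a j assume a: "a \<in> ?X" and j: "j \<in> {1..length P}"
    have "?s a \<in> ?X" by (rule slot_act_mem[OF _ a]) (rule \<sigma>)
    then have "?s a j \<in> multi_indices n d" using j by (rule PiE_mem)
    moreover have "a j \<in> multi_indices n d" using a j by (rule PiE_mem)
    moreover have "P ! (j - 1) \<in> {1..m}" using word_letter[OF j] P by blast
    ultimately show "(\<lambda>M. M (P ! (j - 1)) (a j, ?s a j)) \<in>
      {\<lambda>M. M p (a, b) | p a b. p \<in> {1..m} \<and> a \<in> multi_indices n d \<and> b \<in> multi_indices n d}"
      by (intro CollectI exI conjI) (rule refl)
  qed
  ultimately show ?thesis by (simp only:)
qed

lemma trace_algebra_subset_invariant_ring:
  "algebra_generated (End_power n d m)
      {tensor_trace_word n d P \<sigma> | P \<sigma>.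
         P \<noteq> [] \<and> set P \<subseteq> {1..m} \<and> (\<forall>i\<in>{1..n}. \<sigma> i permutes {1..length P})}
    \<subseteq> (invariant_ring n d m :: ((nat \<Rightarrow> 'k::field tensor_mat) \<Rightarrow> 'k) set)"
proof
  fix f :: "(nat \<Rightarrow> 'k tensor_mat) \<Rightarrow> 'k"
  assume "f \<in> algebra_generated (End_power n d m)
      {tensor_trace_word n d P \<sigma> | P \<sigma>.
         P \<noteq> [] \<and> set P \<subseteq> {1..m} \<and> (\<forall>i\<in>{1..n}. \<sigma> i permutes {1..length P})}"
  then show "f \<in> invariant_ring n d m"
  proof (induction rule: algebra_generated.induct)
    case (const c)
    show ?case unfolding invariant_ring_def
    proof (intro CollectI conjI ballI)
      show "(\<lambda>M\<in>End_power n d m. c) \<in> polynomial_functions n d m"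
        unfolding polynomial_functions_def by (rule algebra_generated.const)
    qed (simp add: simultaneous_conj_closed)
  next
    case (gen f)
    then obtain P \<sigma> where f: "f = tensor_trace_word n d P \<sigma>" and P: "set P \<subseteq> {1..m}"
      and \<sigma>: "\<forall>i\<in>{1..n}. \<sigma> i permutes {1..length P}" by blast
    show ?case unfolding invariant_ring_def
    proof (intro CollectI conjI ballI)
      show "restrict f (End_power n d m) \<in> polynomial_functions n d m"
        unfolding f by (rule tensor_trace_word_polynomial[OF P]) (use \<sigma> in blast)
    next
      fix g :: "nat \<Rightarrow> 'k mat" and M :: "nat \<Rightarrow> 'k tensor_mat"
      assume g: "g \<in> GL_prod n d" and M: "M \<in> End_power n d m"
      have "f (simultaneous_conj n d m g M) = f M"
        unfolding f by (rule tensor_trace_word_invariant[OF P _ g M]) (use \<sigma> in blast)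
      then show "restrict f (End_power n d m) (simultaneous_conj n d m g M) = restrict f (End_power n d m) M"
        using M by (simp add: simultaneous_conj_closed)
    qed
  next
    case (add f h)
    then have "f \<in> polynomial_functions n d m" "h \<in> polynomial_functions n d m"
      by (simp_all only: invariant_ring_def mem_Collect_eq)
    then have closed: "(\<lambda>M\<in>End_power n d m. f M + h M) \<in> polynomial_functions n d m"
      unfolding polynomial_functions_def by (rule algebra_generated.add)
    show ?case unfolding invariant_ring_def
      by (intro CollectI conjI ballI closed)
        (use add.IH in \<open>simp add: invariant_ring_def simultaneous_conj_closed\<close>)
  next
    case (mult f h)
    then have "f \<in> polynomial_functions n d m" "h \<in> polynomial_functions n d m"
      by (simp_all only: invariant_ring_def mem_Collect_eq)
    then have closed: "(\<lambda>M\<in>End_power n d m. f M * h M) \<in> polynomial_functions n d m"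
      unfolding polynomial_functions_def by (rule algebra_generated.mult)
    show ?case unfolding invariant_ring_def
      by (intro CollectI conjI ballI closed)
        (use mult.IH in \<open>simp add: invariant_ring_def simultaneous_conj_closed\<close>)
  qed
qed

section \<open>Invariant polynomials are generated by trace functions\<close>

text \<open>
  With the argument numbers \<open>p\<close> fixed, the coefficients of a polynomial form the matrix of a
  multilinear form.
\<close>

definition slot_coeffs :: "(nat \<Rightarrow> (nat \<Rightarrow> nat \<times> 'i \<times> 'i) \<Rightarrow> 'k) \<Rightarrow> nat \<Rightarrow> (nat \<Rightarrow> nat) \<Rightarrow>
    (nat \<Rightarrow> 'i) \<Rightarrow> (nat \<Rightarrow> 'i) \<Rightarrow> 'k" where
  "slot_coeffs F l p a b = F l (\<lambda>j\<in>{1..l}. (p j, a j, b j))"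

lemma sum_words_split:
  fixes F :: "nat \<Rightarrow> (nat \<Rightarrow> nat \<times> 'i \<times> 'i) \<Rightarrow> 'k::comm_semiring_1"
  shows "(\<Sum>u\<in>{1..l} \<rightarrow>\<^sub>E {1..m} \<times> I \<times> I. F l u * (\<Prod>j=1..l. M (fst (u j)) (snd (u j)))) =
    (\<Sum>p\<in>{1..l} \<rightarrow>\<^sub>E {1..m}. \<Sum>a\<in>{1..l} \<rightarrow>\<^sub>E I. \<Sum>b\<in>{1..l} \<rightarrow>\<^sub>E I.
      slot_coeffs F l p a b * (\<Prod>j=1..l. M (p j) (a j, b j)))"
  unfolding sum_PiE_Times
proof (intro sum.cong[OF refl] arg_cong2[where f = times] prod.cong[OF refl])
  fix p :: "nat \<Rightarrow> nat" and a b :: "nat \<Rightarrow> 'i"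
  have "(\<lambda>j\<in>{1..l}. (p j, (\<lambda>j\<in>{1..l}. (a j, b j)) j)) = (\<lambda>j\<in>{1..l}. (p j, a j, b j))"
    by (intro restrict_ext) simp
  then show "F l (\<lambda>j\<in>{1..l}. (p j, (\<lambda>j\<in>{1..l}. (a j, b j)) j)) = slot_coeffs F l p a b"
    unfolding slot_coeffs_def by (rule arg_cong)
qed simp

lemma compose_permutes_mem:
  assumes "\<pi> permutes J" and "a \<in> J \<rightarrow>\<^sub>E A"
  shows "a \<circ> \<pi> \<in> J \<rightarrow>\<^sub>E A"
proof (rule PiE_I)
  show "(a \<circ> \<pi>) j \<in> A" if "j \<in> J" for j
    using PiE_mem[OF assms(2), of "\<pi> j"] permutes_in_image[OF assms(1)] that by simp
  show "(a \<circ> \<pi>) j = undefined" if "j \<notin> J" for j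
    using PiE_arb[OF assms(2) that] permutes_not_in[OF assms(1) that] by simp
qed

lemma bij_betw_compose_permutes:
  assumes \<pi>: "\<pi> permutes J"
  shows "bij_betw (\<lambda>a. a \<circ> \<pi>) (J \<rightarrow>\<^sub>E A) (J \<rightarrow>\<^sub>E A)"
proof (rule bij_betw_byWitness[where f' = "\<lambda>a. a \<circ> Hilbert_Choice.inv \<pi>"])
  show "(\<lambda>a. a \<circ> \<pi>) ` (J \<rightarrow>\<^sub>E A) \<subseteq> J \<rightarrow>\<^sub>E A"
    by (intro image_subsetI compose_permutes_mem \<pi>)
  show "(\<lambda>a. a \<circ> Hilbert_Choice.inv \<pi>) ` (J \<rightarrow>\<^sub>E A) \<subseteq> J \<rightarrow>\<^sub>E A"
    by (intro image_subsetI compose_permutes_mem permutes_inv \<pi>)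
qed (simp_all add: comp_assoc permutes_inv_o[OF \<pi>])

lemma slot_coeffs_permute:
  assumes F: "symmetric_coeffs ({1..m} \<times> I \<times> I) F" and \<pi>: "\<pi> permutes {1..l}"
    and "p \<in> {1..l} \<rightarrow>\<^sub>E {1..m}" "a \<in> {1..l} \<rightarrow>\<^sub>E I" "b \<in> {1..l} \<rightarrow>\<^sub>E I"
  shows "slot_coeffs F l (p \<circ> \<pi>) (a \<circ> \<pi>) (b \<circ> \<pi>) = slot_coeffs F l p a b"
proof -
  let ?u = "\<lambda>j\<in>{1..l}. (p j, a j, b j)"
  have "?u \<in> {1..l} \<rightarrow>\<^sub>E {1..m} \<times> I \<times> I" using assms(3-5) by (auto dest: PiE_mem)
  moreover have "(\<lambda>j\<in>{1..l}. ((p \<circ> \<pi>) j, (a \<circ> \<pi>) j, (b \<circ> \<pi>) j)) = ?u \<circ> \<pi>"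
    using permutes_in_image[OF \<pi>] by (auto simp: fun_eq_iff restrict_def)
  ultimately show ?thesis
    using F \<pi> unfolding slot_coeffs_def symmetric_coeffs_def by auto
qed

lemma slot_kernel_permute:
  assumes "\<pi> permutes {1..l}"
  shows "slot_kernel l G (a \<circ> \<pi>) (b \<circ> \<pi>) = slot_kernel l G a b"
  unfolding slot_kernel_def using prod.permute[OF assms, of "\<lambda>j. G (b j, a j)"] by (simp add: comp_def)

text \<open>
  These are the coefficients of the polynomial \<open>f (G M) - f (M G)\<close>, if \<open>F\<close> gives those of \<open>f\<close>.
\<close>

definition commutator_coeffs where
  "commutator_coeffs n d G F l p = (\<lambda>x y.
     (\<Sum>z\<in>slot_tuples n d l. slot_kernel l G x z * slot_coeffs F l p z y) -
     (\<Sum>z\<in>slot_tuples n d l. slot_coeffs F l p x z * slot_kernel l G z y))"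

text \<open>
  Permuting all \<open>l\<close> positions simultaneously preserves the tensor power of \<open>G\<close>, so the commutator
  inherits the symmetry of \<open>F\<close>.
\<close>

lemma commutator_coeffs_permute:
  assumes F: "symmetric_coeffs ({1..m} \<times> multi_indices n d \<times> multi_indices n d) F"
    and \<pi>: "\<pi> permutes {1..l}" and p: "p \<in> {1..l} \<rightarrow>\<^sub>E {1..m}"
    and x: "x \<in> slot_tuples n d l" and y: "y \<in> slot_tuples n d l"
  shows "commutator_coeffs n d G F l (p \<circ> \<pi>) (x \<circ> \<pi>) (y \<circ> \<pi>) = commutator_coeffs n d G F l p x y"
proof -
  let ?X = "slot_tuples n d l"
  note reindex = sum.reindex_bij_betw[OF bij_betw_compose_permutes[OF \<pi>], symmetric]
  have "(\<Sum>z\<in>?X. slot_kernel l G (x \<circ> \<pi>) z * slot_coeffs F l (p \<circ> \<pi>) z (y \<circ> \<pi>)) =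
      (\<Sum>z\<in>?X. slot_kernel l G x z * slot_coeffs F l p z y)"
    unfolding reindex[of "\<lambda>z. slot_kernel l G (x \<circ> \<pi>) z * slot_coeffs F l (p \<circ> \<pi>) z (y \<circ> \<pi>)"]
    by (intro sum.cong[OF refl]) (simp only: slot_kernel_permute[OF \<pi>] slot_coeffs_permute[OF F \<pi> p _ y])
  moreover have "(\<Sum>z\<in>?X. slot_coeffs F l (p \<circ> \<pi>) (x \<circ> \<pi>) z * slot_kernel l G z (y \<circ> \<pi>)) =
      (\<Sum>z\<in>?X. slot_coeffs F l p x z * slot_kernel l G z y)"
    unfolding reindex[of "\<lambda>z. slot_coeffs F l (p \<circ> \<pi>) (x \<circ> \<pi>) z * slot_kernel l G z (y \<circ> \<pi>)"]
    by (intro sum.cong[OF refl]) (simp only: slot_kernel_permute[OF \<pi>] slot_coeffs_permute[OF F \<pi> p x])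
  ultimately show ?thesis unfolding commutator_coeffs_def by (simp only:)
qed

text \<open>
  Uniqueness of symmetric coefficients. By independence of monomials, the coefficients of all words
  with the same monomial add up to zero. These words are the rearrangements of one word, so their
  coefficients are equal, and each of them is zero in characteristic zero.
\<close>

lemma symmetric_commutator_coeffs_eq_0:
  fixes F :: "nat \<Rightarrow> (nat \<Rightarrow> nat \<times> (nat \<Rightarrow> nat) \<times> (nat \<Rightarrow> nat)) \<Rightarrow> 'k::field_char_0"
  assumes F: "symmetric_coeffs ({1..m} \<times> multi_indices n d \<times> multi_indices n d) F"
    and zero: "\<And>M. M \<in> End_power n d m \<Longrightarrow>
      (\<Sum>l\<le>L. \<Sum>p\<in>{1..l} \<rightarrow>\<^sub>E {1..m}.
        slot_form n d l (commutator_coeffs n d G F l p) (\<lambda>j. M (p j))) = 0"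
    and l: "l \<le> L" and p: "p \<in> {1..l} \<rightarrow>\<^sub>E {1..m}"
    and x: "x \<in> slot_tuples n d l" and y: "y \<in> slot_tuples n d l"
  shows "commutator_coeffs n d G F l p x y = 0"
proof -
  let ?I = "multi_indices n d"
  let ?X = "\<lambda>l::nat. {1..l} \<rightarrow>\<^sub>E ?I" and ?P = "\<lambda>l::nat. {1..l} \<rightarrow>\<^sub>E {1..m}"
  define W where "W = (SIGMA l:{..L}. ?P l \<times> ?X l \<times> ?X l)"
  define D where "D = (\<lambda>(l, p, x, y). commutator_coeffs n d G F l p x y)"
  define u where "u = (\<lambda>(l :: nat, p :: nat \<Rightarrow> nat, x :: nat \<Rightarrow> nat \<Rightarrow> nat, y :: nat \<Rightarrow> nat \<Rightarrow> nat) j.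
    (p j, x j, y j))"
  have finX: "finite (?X l)" for l by (intro finite_PiE finite_multi_indices finite_atLeastAtMost)
  have finP: "finite (?P l)" for l by (intro finite_PiE finite_atLeastAtMost)
  have finW: "finite W" unfolding W_def using finX finP by (intro finite_SigmaI finite_cartesian_product) auto
  have vanish: "(\<Sum>q\<in>W. D q * (\<Prod>j\<in>{1..fst q}. v (u q j))) = 0"
    for v :: "nat \<times> (nat \<Rightarrow> nat) \<times> (nat \<Rightarrow> nat) \<Rightarrow> 'k"
  proof -
    \<comment> \<open>Arbitrary values of the variables are the entries of some tuple of endomorphisms.\<close>
    define M where "M = (\<lambda>p\<in>{1..m}. \<lambda>t\<in>?I \<times> ?I. v (p, t))"
    have M: "M \<in> End_power n d m" unfolding M_def End_power_def End_tensor_def by auto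
    have "(\<Sum>q\<in>W. D q * (\<Prod>j\<in>{1..fst q}. v (u q j))) =
        (\<Sum>l\<le>L. \<Sum>p\<in>?P l. \<Sum>x\<in>?X l. \<Sum>y\<in>?X l.
          commutator_coeffs n d G F l p x y * (\<Prod>j=1..l. v (p j, x j, y j)))"
      unfolding W_def using finX finP
      by (simp add: sum.Sigma sum.cartesian_product case_prod_unfold D_def u_def)
    also have "\<dots> = (\<Sum>l\<le>L. \<Sum>p\<in>?P l.
        slot_form n d l (commutator_coeffs n d G F l p) (\<lambda>j. M (p j)))"
      unfolding slot_form_def
    proof (intro sum.cong[OF refl] arg_cong2[where f = times] refl prod.cong[OF refl])
      fix l p x y j assume "p \<in> ?P l" "x \<in> ?X l" "y \<in> ?X l" and j: "j \<in> {1..l}"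
      then have "p j \<in> {1..m}" "x j \<in> ?I" "y j \<in> ?I" by (blast dest: PiE_mem)+
      then show "v (p j, x j, y j) = M (p j) (x j, y j)" unfolding M_def by simp
    qed
    also have "\<dots> = 0" by (rule zero[OF M])
    finally show ?thesis .
  qed
  define q0 where "q0 = (l, p, x, y)"
  have q0: "q0 \<in> W" unfolding W_def q0_def using l p x y by blast
  let ?same = "\<lambda>q. \<forall>v :: _ \<Rightarrow> 'k. (\<Prod>j\<in>{1..fst q}. v (u q j)) = (\<Prod>j\<in>{1..fst q0}. v (u q0 j))"
  have D_eq: "D q = D q0" if q: "q \<in> W" and same: "?same q" for q
  proof -
    obtain l' p' x' y' where q_eq: "q = (l', p', x', y')" by (metis surj_pair)
    have p': "p' \<in> ?P l'" and x': "x' \<in> ?X l'" and y': "y' \<in> ?X l'" using q unfolding W_def q_eq by auto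
    have card: "card {j \<in> {1..l'}. u q j \<in> A} = card {j \<in> {1..l}. u q0 j \<in> A}" for A
      using monomial_eq_imp_card_eq[where J = "{1..l'}" and J' = "{1..l}" and u = "u q" and u' = "u q0",
          OF spec[OF same[unfolded q_eq q0_def fst_conv, folded q_eq q0_def]]] by simp
    have "card {1..l'} = card {1..l}" using card[of UNIV] by (simp only: UNIV_I simp_thms Collect_mem_eq)
    then have l': "l' = l" by simp
    have fibres: "card {j \<in> {1..l}. u q j = v} = card {j \<in> {1..l}. u q0 j = v}" for v
      using card[of "{v}"] unfolding l' by simp
    obtain \<pi> where \<pi>: "\<pi> permutes {1..l}" and eq: "\<And>j. j \<in> {1..l} \<Longrightarrow> u q j = u q0 (\<pi> j)"
      using same_fibre_cards_imp_permutes[OF finite_atLeastAtMost fibres] by metis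
    have eqs: "p' j = (p \<circ> \<pi>) j" "x' j = (x \<circ> \<pi>) j" "y' j = (y \<circ> \<pi>) j" if "j \<in> {1..l}" for j
      using eq[OF that] by (simp_all add: u_def q_eq q0_def)
    have "p' = p \<circ> \<pi>" by (rule PiE_ext[OF p'[unfolded l'] compose_permutes_mem[OF \<pi> p] eqs(1)])
    moreover have "x' = x \<circ> \<pi>" by (rule PiE_ext[OF x'[unfolded l'] compose_permutes_mem[OF \<pi> x] eqs(2)])
    moreover have "y' = y \<circ> \<pi>" by (rule PiE_ext[OF y'[unfolded l'] compose_permutes_mem[OF \<pi> y] eqs(3)])
    ultimately show ?thesis
      unfolding D_def q_eq q0_def l' using commutator_coeffs_permute[OF F \<pi> p x y] by simp
  qed
  define C where "C = {q. q \<in> W \<and> ?same q}"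
  have "of_nat (card C) * D q0 = (\<Sum>q\<in>C. D q)"
    unfolding C_def using D_eq by simp
  also have "\<dots> = 0" unfolding C_def
    by (rule monomials_independent[where c = D and u = u and J = "\<lambda>q. {1..fst q}", OF finW vanish q0])
  finally have "of_nat (card C) * D q0 = 0" .
  moreover have "q0 \<in> C" "finite C" unfolding C_def using q0 finW by simp_all
  then have "card C \<noteq> 0" by auto
  ultimately have "D q0 = 0" by simp
  then show ?thesis by (simp add: D_def q0_def)
qed

text \<open>
  The algebra of trace functions contains every summand of the normal form of \<open>f\<close>, because
  its matrix commutes with all transposed tensor powers. The empty word contributes a constant.
\<close>

lemma invariant_ring_subset_trace_algebra:
  fixes f :: "(nat \<Rightarrow> 'k::field_char_0 tensor_mat) \<Rightarrow> 'k"
  assumes f: "f \<in> invariant_ring n d m"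
  shows "f \<in> algebra_generated (End_power n d m)
      {tensor_trace_word n d P \<sigma> | P \<sigma>.
         P \<noteq> [] \<and> set P \<subseteq> {1..m} \<and> (\<forall>i\<in>{1..n}. \<sigma> i permutes {1..length P})}"
    (is "_ \<in> algebra_generated ?W ?T")
proof -
  let ?I = "multi_indices n d"
  let ?X = "\<lambda>l::nat. {1..l} \<rightarrow>\<^sub>E ?I" and ?P = "\<lambda>l::nat. {1..l} \<rightarrow>\<^sub>E {1..m}"
  let ?V = "{1..m} \<times> ?I \<times> ?I"
  have poly: "f \<in> polynomial_functions n d m" using f by (simp add: invariant_ring_def)
  have gens: "{\<lambda>M :: nat \<Rightarrow> 'k tensor_mat. M p (a, b) | p a b. p \<in> {1..m} \<and> a \<in> ?I \<and> b \<in> ?I} =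
      {\<lambda>M. M (fst v) (snd v) | v. v \<in> ?V}" by force
  have "f \<in> algebra_generated ?W {\<lambda>M. M (fst v) (snd v) | v. v \<in> ?V}"
    using poly unfolding polynomial_functions_def gens .
  from polynomial_symmetric_normal_form[where e = "\<lambda>M v. M (fst v) (snd v)", OF this]
  obtain L F where F: "symmetric_coeffs ?V F"
    and f_words: "\<forall>M\<in>?W. f M = (\<Sum>l\<le>L. \<Sum>u\<in>{1..l} \<rightarrow>\<^sub>E ?V. F l u * (\<Prod>j=1..l. M (fst (u j)) (snd (u j))))"
    using finite_multi_indices by auto
  have f_eq: "f M = (\<Sum>l\<le>L. \<Sum>p\<in>?P l. slot_form n d l (slot_coeffs F l p) (\<lambda>j. M (p j)))"
    if "M \<in> ?W" for M
    using f_words that unfolding sum_words_split slot_form_def by simp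
  have commute: "commutator_coeffs n d (simple_tensor n d g) F l p x y = 0"
    if g: "g \<in> GL_prod n d" and "l \<le> L" "p \<in> ?P l" "x \<in> ?X l" "y \<in> ?X l" for g l p x y
  proof (rule symmetric_commutator_coeffs_eq_0[OF F _ that(2-5)])
    fix M :: "nat \<Rightarrow> 'k tensor_mat" assume M: "M \<in> ?W"
    let ?g = "simple_tensor n d g"
    let ?gM = "\<lambda>p\<in>{1..m}. tensor_mat_mult n d ?g (M p)" and ?Mg = "\<lambda>p\<in>{1..m}. tensor_mat_mult n d (M p) ?g"
    have mem: "?gM \<in> ?W" "?Mg \<in> ?W"
      unfolding End_power_def by (auto intro: tensor_mat_mult_closed)
    have "slot_form n d l (commutator_coeffs n d ?g F l p) (\<lambda>j. M (p j)) =
        slot_form n d l (slot_coeffs F l p) (\<lambda>j. ?gM (p j)) -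
        slot_form n d l (slot_coeffs F l p) (\<lambda>j. ?Mg (p j))" if "p \<in> ?P l" for l p
    proof -
      have pj: "p j \<in> {1..m}" if "j \<in> {1..l}" for j using PiE_mem[OF \<open>p \<in> ?P l\<close> that] .
      have "slot_form n d l (slot_coeffs F l p) (\<lambda>j. ?gM (p j)) =
          slot_form n d l (slot_coeffs F l p) (\<lambda>j. tensor_mat_mult n d ?g (M (p j)))"
        "slot_form n d l (slot_coeffs F l p) (\<lambda>j. ?Mg (p j)) =
          slot_form n d l (slot_coeffs F l p) (\<lambda>j. tensor_mat_mult n d (M (p j)) ?g)"
        using pj by (intro slot_form_cong refl; simp)+
      then show ?thesis
        by (simp only: slot_form_mult_left slot_form_mult_right commutator_coeffs_def slot_form_diff)
    qed
    then have "(\<Sum>l\<le>L. \<Sum>p\<in>?P l. slot_form n d l (commutator_coeffs n d ?g F l p) (\<lambda>j. M (p j))) =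
        f ?gM - f ?Mg"
      unfolding f_eq[OF mem(1)] f_eq[OF mem(2)] sum_subtractf[symmetric]
      by (intro sum.cong[OF refl]) simp
    also have "\<dots> = 0"
    proof -
      have "\<forall>M\<in>?W. f (simultaneous_conj n d m g M) = f M"
        using f g unfolding invariant_ring_def by blast
      from bspec[OF this[unfolded conj_invariant_iff[OF g]] M] show ?thesis by (simp only: diff_self)
    qed
    finally show "(\<Sum>l\<le>L. \<Sum>p\<in>?P l.
        slot_form n d l (commutator_coeffs n d ?g F l p) (\<lambda>j. M (p j))) = 0" .
  qed
  have component: "(\<lambda>M\<in>?W. slot_form n d l (slot_coeffs F l p) (\<lambda>j. M (p j))) \<in> algebra_generated ?W ?T"
    if l: "l \<le> L" and p: "p \<in> ?P l" for l p
  proof (cases "l = 0")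
    case True
    then have "(\<lambda>M\<in>?W. slot_form n d l (slot_coeffs F l p) (\<lambda>j. M (p j))) =
        (\<lambda>M\<in>?W. \<Sum>x\<in>?X 0. \<Sum>y\<in>?X 0. slot_coeffs F 0 p x y)"
      unfolding slot_form_def by simp
    then show ?thesis by (simp only: algebra_generated.const)
  next
    case False
    have "(\<Sum>z\<in>?X l. slot_kernel l (simple_tensor n d g) x z * slot_coeffs F l p z y) =
        (\<Sum>z\<in>?X l. slot_coeffs F l p x z * slot_kernel l (simple_tensor n d g) z y)"
      if "g \<in> GL_prod n d" "x \<in> ?X l" "y \<in> ?X l" for g x y
      using commute[OF that(1) l p that(2,3)] unfolding commutator_coeffs_def by simp
    note comm = this
    have "\<exists>\<Sigma> c. finite \<Sigma> \<and> (\<forall>\<sigma>\<in>\<Sigma>. \<forall>i\<in>{1..n}. \<sigma> i permutes {1..l}) \<and>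
        (\<forall>x\<in>?X l. \<forall>y\<in>?X l. slot_coeffs F l p x y = (\<Sum>\<sigma>\<in>\<Sigma>. c \<sigma> * of_bool (y = slot_act n l \<sigma> x)))"
      by (rule GL_commutant_spanned_by_slot_acts) (rule comm; assumption)
    then obtain \<Sigma> c where \<Sigma>: "finite \<Sigma>" "\<forall>\<sigma>\<in>\<Sigma>. \<forall>i\<in>{1..n}. \<sigma> i permutes {1..l}"
      and c: "\<forall>x\<in>?X l. \<forall>y\<in>?X l. slot_coeffs F l p x y = (\<Sum>\<sigma>\<in>\<Sigma>. c \<sigma> * of_bool (y = slot_act n l \<sigma> x))"
      by (elim exE conjE)
    define P where "P = map p [1..<Suc l]"
    have P: "P \<noteq> []" "length P = l" "set P \<subseteq> {1..m}"
      using False PiE_mem[OF p] by (auto simp: P_def)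
    have nth: "P ! (j - 1) = p j" if "j \<in> {1..l}" for j
      using that by (auto simp: P_def simp del: upt_Suc)
    have "(\<lambda>M\<in>?W. \<Sum>\<sigma>\<in>\<Sigma>. c \<sigma> * tensor_trace_word n d P \<sigma> M) \<in> algebra_generated ?W ?T"
    proof (intro algebra_generated_sum algebra_generated_scale \<Sigma>(1))
      fix \<sigma> assume "\<sigma> \<in> \<Sigma>"
      then have "\<forall>i\<in>{1..n}. \<sigma> i permutes {1..length P}" unfolding P(2) using \<Sigma>(2) by blast
      then have "tensor_trace_word n d P \<sigma> \<in> ?T" using P by blast
      then show "restrict (tensor_trace_word n d P \<sigma>) ?W \<in> algebra_generated ?W ?T"
        by (rule algebra_generated.gen)
    qed
    moreover have "slot_form n d l (slot_coeffs F l p) (\<lambda>j. M (p j)) =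
        (\<Sum>\<sigma>\<in>\<Sigma>. c \<sigma> * tensor_trace_word n d P \<sigma> M)" for M
    proof -
      have "slot_form n d l (slot_coeffs F l p) (\<lambda>j. M (p j)) =
          (\<Sum>\<sigma>\<in>\<Sigma>. c \<sigma> * tensor_trace n d l \<sigma> (\<lambda>j. M (p j)))"
        by (rule slot_form_perm_sum[OF \<Sigma>(1)]) (use \<Sigma>(2) c in blast)+
      also have "\<dots> = (\<Sum>\<sigma>\<in>\<Sigma>. c \<sigma> * tensor_trace_word n d P \<sigma> M)"
        unfolding tensor_trace_word_def P(2)
        by (intro sum.cong[OF refl] arg_cong2[where f = times] refl tensor_trace_cong) (simp only: nth)
      finally show ?thesis .
    qed
    ultimately show ?thesis by (simp only:)
  qed
  have "(\<lambda>M\<in>?W. \<Sum>l\<le>L. \<Sum>p\<in>?P l. slot_form n d l (slot_coeffs F l p) (\<lambda>j. M (p j)))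
      \<in> algebra_generated ?W ?T"
    using component by (intro algebra_generated_sum finite_PiE finite_atMost finite_atLeastAtMost) auto
  moreover have "f = (\<lambda>M\<in>?W. \<Sum>l\<le>L. \<Sum>p\<in>?P l. slot_form n d l (slot_coeffs F l p) (\<lambda>j. M (p j)))"
  proof -
    have "f = restrict f ?W"
      using algebra_generated_extensional[OF poly[unfolded polynomial_functions_def]]
      by (rule extensional_restrict[symmetric])
    also have "\<dots> = (\<lambda>M\<in>?W. \<Sum>l\<le>L. \<Sum>p\<in>?P l. slot_form n d l (slot_coeffs F l p) (\<lambda>j. M (p j)))"
      by (intro restrict_ext f_eq)
    finally show ?thesis .
  qed
  ultimately show ?thesis by (simp only:)
qed

theorem theorem3p5:
  fixes n m :: nat and d :: "nat \<Rightarrow> nat"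
  shows "(invariant_ring n d m ::
      ((nat \<Rightarrow> 'k::{alg_closed_field, field_char_0} tensor_mat) \<Rightarrow> 'k) set) =
    algebra_generated (End_power n d m)
      {tensor_trace_word n d P \<sigma> | P \<sigma>.
         P \<noteq> [] \<and> set P \<subseteq> {1..m} \<and> (\<forall>i\<in>{1..n}. \<sigma> i permutes {1..length P})}"
  using invariant_ring_subset_trace_algebra trace_algebra_subset_invariant_ring by blast

end
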